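(* Let $(x_n)_n$ be a frame or an outer frame for a Hilbert $C^*$-module $X$ over a $C^*$-algebra $\mathsf{A}$, with analysis operator $U$ and optimal frame bounds $A$ and $B$. If $(y_n)_n$ is the Parseval frame (or outer Parseval frame) canonically associated with $(x_n)_n$, then its analysis operator $U(U^*U)^{-\frac12}$ satisfies $$\left\|U-U(U^*U)^{-\frac12}\right\|=\max\left\{1-\sqrt{A},\sqrt{B}-1\right\}.$$ If $(y_n)_n$ is any Parseval frame or outer Parseval frame for $X$, then its analysis operator $V$ satisfies $$\|U-V\|\ge\max\left\{1-\sqrt{A},\sqrt{B}-1\right\}.$$
   Context: $\mathsf{A}$ is an arbitrary $C^*$-algebra (not necessarily unital) with multiplier algebra $M(\mathsf{A})$. Hilbert $\mathsf{A}$-modules are right modules with inner product $\mathsf{A}$-linear in the second variable; they are not assumed full. $\mathbb{B}(X,Y)$ denotes the adjointable operators from $X$ to $Y$. $\ell^2(\mathsf{A})$ is the Hilbert $\mathsf{A}$-module of sequences $(a_n)_n$ in $\mathsf{A}$ with $\sum_n a_n^*a_n$ norm convergent, with inner product $\langle (a_n)_n,(b_n)_n\rangle=\sum_n a_n^*b_n$. $M(X)$ denotes the multiplier module of $X$: $M(X)=\mathbb{B}(\mathsf{A},X)$, a Hilbert $M(\mathsf{A})$-module with $\langle v,w\rangle=v^*w\in\mathbb{B}(\mathsf{A})=M(\mathsf{A})$, containing $X$ via $x\mapsto(a\mapsto xa)$, and $M(X)\mathsf{A}=X$; thus $\langle v,x\rangle\in\mathsf{A}$ for $v\in M(X)$,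 $x\in X$. Each $T\in\mathbb{B}(X,Y)$ extends uniquely to $T_M\in\mathbb{B}(M(X),M(Y))$, $T_Mv=T\circ v$. All sequences are infinite, indexed by $\mathbb{N}$ (finite frames are extended by zeros). A sequence $(x_n)_n$ in $X$ is a frame for $X$ if there are constants $A,B>0$ with $A\langle x,x\rangle\le\sum_{n=1}^\infty\langle x,x_n\rangle\langle x_n,x\rangle\le B\langle x,x\rangle$ for all $x\in X$, the series converging in norm. A sequence $(x_n)_n$ in $M(X)$ is an outer frame for $X$ if $x_n\in M(X)\setminus X$ for at least one $n$ and the same inequalities hold for all $x\in X$ (with norm convergence in $\mathsf{A}$) for some $A,B>0$. If one can take $A=B=1$, the (outer) frame is called Parseval. The optimal frame bounds are the largest possible $A$ and the smallest possible $B$. The analysis operator of a frame or outer frame $(x_n)_n$ is $U\in\mathbb{B}(X,\ell^2(\mathsf{A}))$, $Ux=(\langle x_n,x\rangle)_n$; $U^*U$ is invertible in $\mathbb{B}(X)$. The Parseval frame or outer Parseval frame canonically associated with $(x_n)_n$ is $(y_n)_n$ with $y_n=(U_M^*U_M)^{-\frac12}x_n$ (which equals $(U^*U)^{-\frac12}x_n$ when $x_n\in X$); its analysis operator is $U(U^*U)^{-\frac12}$, and it is outer if and only if $(x_n)_n$ is outer. *)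

theory Defs
  imports "HOL-Analysis.Analysis"
begin

section \<open>C*-algebras\<close>

class complex_banach = banach +
  fixes scaleC :: "complex \<Rightarrow> 'a \<Rightarrow> 'a" (infixr \<open>*\<^sub>C\<close> 75)
  assumes scaleC_add_right: "c *\<^sub>C (x + y) = c *\<^sub>C x + c *\<^sub>C y"
    and scaleC_add_left: "(c + d) *\<^sub>C x = c *\<^sub>C x + d *\<^sub>C x"
    and scaleC_scaleC: "c *\<^sub>C (d *\<^sub>C x) = (c * d) *\<^sub>C x"
    and scaleC_of_real: "complex_of_real r *\<^sub>C x = r *\<^sub>R x"
    and norm_scaleC: "norm (c *\<^sub>C x) = cmod c * norm x"

text \<open>No unit is assumed; the zero algebra is included.\<close>

class cstar_algebra = complex_banach + real_normed_algebra +
  fixes star :: "'a \<Rightarrow> 'a"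
  assumes mult_scaleC_left: "(c *\<^sub>C a) * b = c *\<^sub>C (a * b)"
    and mult_scaleC_right: "a * (c *\<^sub>C b) = c *\<^sub>C (a * b)"
    and star_add: "star (a + b) = star a + star b"
    and star_scaleC: "star (c *\<^sub>C a) = cnj c *\<^sub>C star a"
    and star_mult: "star (a * b) = star b * star a"
    and star_star: "star (star a) = a"
    and cstar_identity: "norm (star a * a) = (norm a)\<^sup>2"

definition cstar_pos :: "'a::cstar_algebra \<Rightarrow> bool" where
  "cstar_pos a \<longleftrightarrow> (\<exists>b. a = star b * b)"

definition cstar_le :: "'a::cstar_algebra \<Rightarrow> 'a \<Rightarrow> bool" (infix \<open>\<preceq>\<close> 50) where
  "a \<preceq> b \<longleftrightarrow> cstar_pos (b - a)"


section \<open>Hilbert modules\<close>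

locale hilbert_module =
  fixes act :: "'x::complex_banach \<Rightarrow> 'a::cstar_algebra \<Rightarrow> 'x"
    and ip :: "'x \<Rightarrow> 'x \<Rightarrow> 'a"
  assumes act_add_left: "act (x + y) a = act x a + act y a"
    and act_add_right: "act x (a + b) = act x a + act x b"
    and act_mult: "act x (a * b) = act (act x a) b"
    and act_scaleC_left: "act (c *\<^sub>C x) a = c *\<^sub>C act x a"
    and act_scaleC_right: "act x (c *\<^sub>C a) = c *\<^sub>C act x a"
    and ip_add_right: "ip x (y + z) = ip x y + ip x z"
    and ip_scaleC_right: "ip x (c *\<^sub>C y) = c *\<^sub>C ip x y"
    and ip_act_right: "ip x (act y a) = ip x y * a"
    and ip_star: "star (ip x y) = ip y x"
    and ip_pos: "cstar_pos (ip x x)"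
    and norm_eq_ip: "norm x = sqrt (norm (ip x x))"

text \<open>
  Adjointability depends only on the underlying set and the inner product. The modules
  $\ell^2(A)$ and $M(X)$ do not have the whole of a type as their underlying set, so
  operators are defined relative to a carrier; they are extensional functions,
  so that equality of operators is equality of functions. The type of inner product values is
  arbitrary because it has to cover $M(A)$ (functions on \<open>'a\<close>) besides $A$.
\<close>

record ('b, 'x) ip_module =
  mcarrier :: "'x set"
  mip :: "'x \<Rightarrow> 'x \<Rightarrow> 'b"

definition adj_pair ::
  "('b, 'x) ip_module \<Rightarrow> ('b, 'y) ip_module \<Rightarrow> ('x \<Rightarrow> 'y) \<Rightarrow> ('y \<Rightarrow> 'x) \<Rightarrow> bool" where
  "adj_pair X Y T S \<longleftrightarrow> (\<forall>x\<in>mcarrier X. \<forall>y\<in>mcarrier Y. mip Y (T x) y = mip X x (S y))"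

definition adjointables ::
  "('b, 'x) ip_module \<Rightarrow> ('b, 'y) ip_module \<Rightarrow> ('x \<Rightarrow> 'y) set" where
  "adjointables X Y =
     {T \<in> mcarrier X \<rightarrow>\<^sub>E mcarrier Y. \<exists>S \<in> mcarrier Y \<rightarrow>\<^sub>E mcarrier X. adj_pair X Y T S}"

definition adj ::
  "('b, 'x) ip_module \<Rightarrow> ('b, 'y) ip_module \<Rightarrow> ('x \<Rightarrow> 'y) \<Rightarrow> 'y \<Rightarrow> 'x" where
  "adj X Y T = (THE S. S \<in> mcarrier Y \<rightarrow>\<^sub>E mcarrier X \<and> adj_pair X Y T S)"

definition op_id :: "('b, 'x) ip_module \<Rightarrow> 'x \<Rightarrow> 'x" where
  "op_id X = (\<lambda>x\<in>mcarrier X. x)"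

definition op_pos :: "('b, 'x) ip_module \<Rightarrow> ('x \<Rightarrow> 'x) \<Rightarrow> bool" where
  "op_pos X T \<longleftrightarrow> (\<exists>S\<in>adjointables X X. T = compose (mcarrier X) (adj X X S) S)"

definition op_inv :: "('b, 'x) ip_module \<Rightarrow> ('x \<Rightarrow> 'x) \<Rightarrow> 'x \<Rightarrow> 'x" where
  "op_inv X T = (THE S. S \<in> adjointables X X \<and>
     compose (mcarrier X) S T = op_id X \<and> compose (mcarrier X) T S = op_id X)"

definition op_sqrt :: "('b, 'x) ip_module \<Rightarrow> ('x \<Rightarrow> 'x) \<Rightarrow> 'x \<Rightarrow> 'x" where
  "op_sqrt X T = (THE S. S \<in> adjointables X X \<and> op_pos X S \<and> compose (mcarrier X) S S = T)"

definition op_inv_sqrt :: "('b, 'x) ip_module \<Rightarrow> ('x \<Rightarrow> 'x) \<Rightarrow> 'x \<Rightarrow> 'x" where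
  "op_inv_sqrt X T = op_sqrt X (op_inv X T)"

definition mnorm :: "('a::cstar_algebra, 'x) ip_module \<Rightarrow> 'x \<Rightarrow> real" where
  "mnorm X x = sqrt (norm (mip X x x))"

definition op_norm ::
  "('a::cstar_algebra, 'x) ip_module \<Rightarrow> ('a, 'y) ip_module \<Rightarrow> ('x \<Rightarrow> 'y) \<Rightarrow> real" where
  "op_norm X Y T = (SUP x \<in> {x \<in> mcarrier X. mnorm X x \<le> 1}. mnorm Y (T x))"

definition alg_mod :: "('a::cstar_algebra, 'a) ip_module" where
  "alg_mod = \<lparr>mcarrier = UNIV, mip = (\<lambda>a b. star a * b)\<rparr>"

definition type_mod :: "('x \<Rightarrow> 'x \<Rightarrow> 'a) \<Rightarrow> ('a, 'x) ip_module" where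
  "type_mod ip = \<lparr>mcarrier = UNIV, mip = ip\<rparr>"

definition l2_mod :: "('a::cstar_algebra, nat \<Rightarrow> 'a) ip_module" where
  "l2_mod = \<lparr>mcarrier = {a. summable (\<lambda>n. star (a n) * a n)},
             mip = (\<lambda>a b. \<Sum>n. star (a n) * b n)\<rparr>"


section \<open>Multiplier modules\<close>

definition mult_mod ::
  "('a::cstar_algebra, 'x) ip_module \<Rightarrow> ('a \<Rightarrow> 'a, 'a \<Rightarrow> 'x) ip_module" where
  "mult_mod X = \<lparr>mcarrier = adjointables alg_mod X,
                 mip = (\<lambda>v w. adj alg_mod X v \<circ> w)\<rparr>"

definition op_ext ::
  "('a::cstar_algebra, 'x) ip_module \<Rightarrow> ('x \<Rightarrow> 'y) \<Rightarrow> ('a \<Rightarrow> 'x) \<Rightarrow> 'a \<Rightarrow> 'y" where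
  "op_ext X T = (\<lambda>v\<in>mcarrier (mult_mod X). T \<circ> v)"

definition mult_embed :: "('x \<Rightarrow> 'a \<Rightarrow> 'x) \<Rightarrow> 'x \<Rightarrow> 'a \<Rightarrow> 'x" where
  "mult_embed act x = (\<lambda>a. act x a)"

text \<open>
  $\langle v,x\rangle\in A$ for $v\in M(X)$, $x\in X$. In $M(X)$ the inner product of $v$ with
  (the image of) $x$ is left multiplication by $v^*x$, see \<open>mip_mult_mod_mult_embed\<close> below; so under
  $A\subseteq M(A)$ it is the element $v^*x$ of $A$.
\<close>

definition pairing ::
  "('x \<Rightarrow> 'x \<Rightarrow> 'a::cstar_algebra) \<Rightarrow> ('a \<Rightarrow> 'x) \<Rightarrow> 'x \<Rightarrow> 'a" where
  "pairing ip v x = adj alg_mod (type_mod ip) v x"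

lemma alg_mod_eqI:
  fixes a a' :: "'a::cstar_algebra"
  assumes "\<And>b. star b * a = star b * a'"
  shows "a = a'"
proof -
  have "star (a - a') * (a - a') = 0"
    by (simp only: right_diff_distrib assms[of "a - a'"] diff_self)
  then have "(norm (a - a'))\<^sup>2 = 0"
    by (simp only: cstar_identity[symmetric] norm_zero)
  then show ?thesis by simp
qed

lemma adj_alg_modI:
  fixes v :: "'a::cstar_algebra \<Rightarrow> 'x"
  assumes S: "\<And>a x. ip (v a) x = star a * S x"
  shows "adj alg_mod (type_mod ip) v = S"
  unfolding adj_def
proof (rule the_equality)
  show "S \<in> mcarrier (type_mod ip) \<rightarrow>\<^sub>E mcarrier alg_mod \<and> adj_pair alg_mod (type_mod ip) v S"
    by (simp add: S adj_pair_def alg_mod_def type_mod_def)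
next
  fix S' assume "S' \<in> mcarrier (type_mod ip) \<rightarrow>\<^sub>E mcarrier alg_mod \<and>
    adj_pair alg_mod (type_mod ip) v S'"
  then have "ip (v b) x = star b * S' x" for b x
    by (simp add: adj_pair_def alg_mod_def type_mod_def)
  then have "star b * S' x = star b * S x" for b x
    by (simp only: S)
  then have "S' x = S x" for x
    by (rule alg_mod_eqI)
  then show "S' = S" ..
qed

lemma pairing_eq:
  fixes v :: "'a::cstar_algebra \<Rightarrow> 'x"
  assumes "v \<in> mcarrier (mult_mod (type_mod ip))"
  shows "ip (v a) x = star a * pairing ip v x"
proof -
  have "v \<in> adjointables alg_mod (type_mod ip)"
    using assms by (simp add: mult_mod_def)
  then obtain S where "adj_pair alg_mod (type_mod ip) v S"
    unfolding adjointables_def by blast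
  then have S: "ip (v a) x = star a * S x" for a x
    by (simp add: adj_pair_def alg_mod_def type_mod_def)
  have "adj alg_mod (type_mod ip) v = S"
    by (rule adj_alg_modI) (rule S)
  then show ?thesis
    by (simp add: pairing_def S)
qed

context hilbert_module
begin

lemma ip_act_left: "ip (act x a) y = star a * ip x y"
proof -
  have "ip (act x a) y = star (ip y (act x a))"
    by (simp only: ip_star)
  then show ?thesis
    by (simp only: ip_act_right star_mult ip_star)
qed

lemma pairing_mult_embed: "pairing ip (mult_embed act z) x = ip z x"
proof -
  have "adj alg_mod (type_mod ip) (mult_embed act z) = ip z"
    by (rule adj_alg_modI) (simp only: mult_embed_def ip_act_left)
  then show ?thesis
    by (simp only: pairing_def)
qed

lemma mult_embed_in_mult_mod: "mult_embed act z \<in> mcarrier (mult_mod (type_mod ip))"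
proof -
  have "adj_pair alg_mod (type_mod ip) (mult_embed act z) (ip z)"
    by (simp add: adj_pair_def alg_mod_def type_mod_def mult_embed_def ip_act_left)
  moreover have "ip z \<in> mcarrier (type_mod ip) \<rightarrow>\<^sub>E mcarrier alg_mod"
    "mult_embed act z \<in> mcarrier alg_mod \<rightarrow>\<^sub>E mcarrier (type_mod ip)"
    by (simp_all add: alg_mod_def type_mod_def)
  ultimately have "mult_embed act z \<in> adjointables alg_mod (type_mod ip)"
    unfolding adjointables_def by blast
  then show ?thesis
    by (simp add: mult_mod_def)
qed

lemma mip_mult_mod_mult_embed:
  assumes "v \<in> mcarrier (mult_mod (type_mod ip))"
  shows "mip (mult_mod (type_mod ip)) v (mult_embed act x) = (\<lambda>a. pairing ip v x * a)"
proof
  fix a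
  have "pairing ip v (act x a) = pairing ip v x * a"
  proof (rule alg_mod_eqI)
    fix b
    have "star b * pairing ip v (act x a) = ip (v b) x * a"
      by (simp only: pairing_eq[OF assms, symmetric] ip_act_right)
    then show "star b * pairing ip v (act x a) = star b * (pairing ip v x * a)"
      by (simp only: pairing_eq[OF assms] mult.assoc)
  qed
  then show "mip (mult_mod (type_mod ip)) v (mult_embed act x) a = pairing ip v x * a"
    by (simp add: mult_mod_def mult_embed_def pairing_def)
qed

end


section \<open>Frames and outer frames\<close>

definition frame_bounds ::
  "('x \<Rightarrow> 'x \<Rightarrow> 'a::cstar_algebra) \<Rightarrow> (nat \<Rightarrow> 'x) \<Rightarrow> real \<Rightarrow> real \<Rightarrow> bool" where
  "frame_bounds ip x A B \<longleftrightarrow> A > 0 \<and> B > 0 \<and>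
     (\<forall>z. summable (\<lambda>n. ip z (x n) * ip (x n) z) \<and>
          A *\<^sub>R ip z z \<preceq> (\<Sum>n. ip z (x n) * ip (x n) z) \<and>
          (\<Sum>n. ip z (x n) * ip (x n) z) \<preceq> B *\<^sub>R ip z z)"

definition outer_frame_bounds ::
  "('x \<Rightarrow> 'a::cstar_algebra \<Rightarrow> 'x) \<Rightarrow> ('x \<Rightarrow> 'x \<Rightarrow> 'a) \<Rightarrow> (nat \<Rightarrow> 'a \<Rightarrow> 'x) \<Rightarrow>
     real \<Rightarrow> real \<Rightarrow> bool" where
  "outer_frame_bounds act ip x A B \<longleftrightarrow> A > 0 \<and> B > 0 \<and>
     (\<forall>n. x n \<in> mcarrier (mult_mod (type_mod ip))) \<and>
     (\<exists>n. x n \<notin> range (mult_embed act)) \<and>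
     (\<forall>z. summable (\<lambda>n. star (pairing ip (x n) z) * pairing ip (x n) z) \<and>
          A *\<^sub>R ip z z \<preceq> (\<Sum>n. star (pairing ip (x n) z) * pairing ip (x n) z) \<and>
          (\<Sum>n. star (pairing ip (x n) z) * pairing ip (x n) z) \<preceq> B *\<^sub>R ip z z)"

text \<open>A frame is regarded as a sequence in $M(X)$ through $X\subseteq M(X)$.\<close>

definition gen_frame_bounds ::
  "('x \<Rightarrow> 'a::cstar_algebra \<Rightarrow> 'x) \<Rightarrow> ('x \<Rightarrow> 'x \<Rightarrow> 'a) \<Rightarrow> (nat \<Rightarrow> 'a \<Rightarrow> 'x) \<Rightarrow>
     real \<Rightarrow> real \<Rightarrow> bool" where
  "gen_frame_bounds act ip x A B \<longleftrightarrow>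
     (\<exists>x'. x = (\<lambda>n. mult_embed act (x' n)) \<and> frame_bounds ip x' A B) \<or>
     outer_frame_bounds act ip x A B"

definition frame_or_outer_frame ::
  "('x \<Rightarrow> 'a::cstar_algebra \<Rightarrow> 'x) \<Rightarrow> ('x \<Rightarrow> 'x \<Rightarrow> 'a) \<Rightarrow> (nat \<Rightarrow> 'a \<Rightarrow> 'x) \<Rightarrow> bool" where
  "frame_or_outer_frame act ip x \<longleftrightarrow> (\<exists>A B. gen_frame_bounds act ip x A B)"

definition parseval_frame_or_outer_frame ::
  "('x \<Rightarrow> 'a::cstar_algebra \<Rightarrow> 'x) \<Rightarrow> ('x \<Rightarrow> 'x \<Rightarrow> 'a) \<Rightarrow> (nat \<Rightarrow> 'a \<Rightarrow> 'x) \<Rightarrow> bool" where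
  "parseval_frame_or_outer_frame act ip x \<longleftrightarrow> gen_frame_bounds act ip x 1 1"

text \<open>Optimal bounds exist only for nonzero $X$.\<close>

definition optimal_frame_bounds ::
  "('x \<Rightarrow> 'a::cstar_algebra \<Rightarrow> 'x) \<Rightarrow> ('x \<Rightarrow> 'x \<Rightarrow> 'a) \<Rightarrow> (nat \<Rightarrow> 'a \<Rightarrow> 'x) \<Rightarrow>
     real \<Rightarrow> real \<Rightarrow> bool" where
  "optimal_frame_bounds act ip x A B \<longleftrightarrow> gen_frame_bounds act ip x A B \<and>
     (\<forall>A' B'. gen_frame_bounds act ip x A' B' \<longrightarrow> A' \<le> A \<and> B \<le> B')"

definition analysis_op ::
  "('x \<Rightarrow> 'x \<Rightarrow> 'a::cstar_algebra) \<Rightarrow> (nat \<Rightarrow> 'a \<Rightarrow> 'x) \<Rightarrow> 'x \<Rightarrow> nat \<Rightarrow> 'a" where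
  "analysis_op ip x z = (\<lambda>n. pairing ip (x n) z)"

definition inv_sqrt_frame_op ::
  "('x \<Rightarrow> 'x \<Rightarrow> 'a::cstar_algebra) \<Rightarrow> (nat \<Rightarrow> 'a \<Rightarrow> 'x) \<Rightarrow> 'x \<Rightarrow> 'x" where
  "inv_sqrt_frame_op ip x =
     (let X = type_mod ip; U = analysis_op ip x
      in op_inv_sqrt X (compose (mcarrier X) (adj X l2_mod U) U))"

definition canonical_parseval ::
  "('x \<Rightarrow> 'x \<Rightarrow> 'a::cstar_algebra) \<Rightarrow> (nat \<Rightarrow> 'a \<Rightarrow> 'x) \<Rightarrow> nat \<Rightarrow> 'a \<Rightarrow> 'x" where
  "canonical_parseval ip x n =
     (let X = type_mod ip; MX = mult_mod X; ML2 = mult_mod l2_mod;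
          U\<^sub>M = op_ext X (analysis_op ip x)
      in op_inv_sqrt MX (compose (mcarrier MX) (adj MX ML2 U\<^sub>M) U\<^sub>M) (x n))"

end

theory Submission
  imports Defs "HOL-Real_Asymp.Real_Asymp"
begin

text \<open>
  Put $T = U^*U$, an operator on \<open>X\<close> with $A\le T\le B$, and $W = T^{1/2}$. Since
  $U^*U = W^2$, the norms of $U$ and $U(1-T^{-1/2})$ are those of $W$ and $W-1$, and
  $\sqrt A\le W\le\sqrt B$ gives $\|W-1\|\le\max\{1-\sqrt A,\sqrt B-1\}$. Conversely, if
  \<open>V\<close> is isometric and $\|U-V\|=c$, then $(1-c)\|z\|\le\|Wz\|\le(1+c)\|z\|$. A self-adjoint
  operator of norm at most \<open>1\<close> is \<open>\<le> 1\<close>, even in the order given by the algebra-valued inner product,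
  because $1-K$ has a self-adjoint square root; applied to $T/(1+c)^2$ and $(1-c)^2T^{-1}$
  this shows that $(1+c)^2$ and $(1-c)^2$ are frame bounds, so that optimality yields
  $\sqrt B\le 1+c$ and $1-c\le\sqrt A$.

  All the square roots needed are those of $1-K$ with $\|K\|\le 1$, obtained by iteration.
\<close>

section \<open>The Banach algebra of bounded operators\<close>

text \<open>The definition of positivity by \<open>star b * b\<close> does not make sums visibly
  positive. Operators are therefore called positive if they are self-adjoint and within norm
  distance t of some scalar t \<ge> 0, a condition stable under sums; that every C* C satisfies it
  is the hard step. It is proved for modules with a Cauchy-Schwarz inequality. The algebra acting on
  itself is such a module, and the positivity obtained there yields Cauchy-Schwarz in every Hilbert
  module. The inverse square roots of the statement are definite descriptions over X and over M(X),
  so uniqueness of the positive root is needed on both. Positivity of a root is in turn witnessed by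
  an adjoint times an operator, which is why a fourth root of T is constructed.\<close>

typedef (overloaded) 'x bop = "UNIV :: ('x::real_normed_vector \<Rightarrow>\<^sub>L 'x) set" ..

setup_lifting type_definition_bop

text \<open>The classes stop short of \<open>real_normed_algebra_1\<close>, whose unit has norm 1:
  on the zero module the identity has norm 0.\<close>

instantiation bop :: (real_normed_vector) "{real_normed_algebra, monoid_mult}"
begin

lift_definition zero_bop :: "'a bop" is 0 .
lift_definition one_bop :: "'a bop" is id_blinfun .
lift_definition plus_bop :: "'a bop \<Rightarrow> 'a bop \<Rightarrow> 'a bop" is "(+)" .
lift_definition minus_bop :: "'a bop \<Rightarrow> 'a bop \<Rightarrow> 'a bop" is "(-)" .
lift_definition uminus_bop :: "'a bop \<Rightarrow> 'a bop" is uminus .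
lift_definition times_bop :: "'a bop \<Rightarrow> 'a bop \<Rightarrow> 'a bop" is blinfun_compose .
lift_definition scaleR_bop :: "real \<Rightarrow> 'a bop \<Rightarrow> 'a bop" is scaleR .
lift_definition norm_bop :: "'a bop \<Rightarrow> real" is norm .

definition "dist S T = norm (S - T)" for S T :: "'a bop"
definition "sgn T = inverse (norm T) *\<^sub>R T" for T :: "'a bop"
definition [code del]:
  "(uniformity :: ('a bop \<times> 'a bop) filter) = (INF e\<in>{0 <..}. principal {(S, T). dist S T < e})"
definition [code del]:
  "open U = (\<forall>S\<in>U. eventually (\<lambda>(S', T). S' = S \<longrightarrow> T \<in> U) uniformity)"
  for U :: "'a bop set"

instance
proof
  fix S T R :: "'a bop" and r s :: real and U :: "'a bop set"
  show "(uniformity :: ('a bop \<times> 'a bop) filter) =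
      (INF e\<in>{0 <..}. principal {(S, T). dist S T < e})"
    by (rule uniformity_bop_def)
  show "open U \<longleftrightarrow> (\<forall>S\<in>U. eventually (\<lambda>(S', T). S' = S \<longrightarrow> T \<in> U) uniformity)"
    by (rule open_bop_def)
  show "S * T * R = S * (T * R)" by transfer (simp add: blinfun_eqI)
  show "norm (S * T) \<le> norm S * norm T" by transfer (rule norm_blinfun_compose)
  show "norm (S + T) \<le> norm S + norm T" by transfer (rule norm_triangle_ineq)
  show "norm (r *\<^sub>R T) = \<bar>r\<bar> * norm T" by transfer simp
  show "norm T = 0 \<longleftrightarrow> T = 0" by transfer simp
  show "S + T + R = S + (T + R)" by transfer (rule add.assoc)
  show "S + T = T + S" by transfer (rule add.commute)
  show "0 + T = T" by transfer (rule add_0)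
  show "- T + T = 0" by transfer (rule left_minus)
  show "S - T = S + - T" by transfer (rule diff_conv_add_uminus)
  show "r *\<^sub>R (S + T) = r *\<^sub>R S + r *\<^sub>R T" by transfer (simp add: scaleR_right_distrib)
  show "(r + s) *\<^sub>R T = r *\<^sub>R T + s *\<^sub>R T" by transfer (simp add: scaleR_left_distrib)
  show "r *\<^sub>R s *\<^sub>R T = (r * s) *\<^sub>R T" by transfer simp
  show "1 *\<^sub>R T = T" by transfer simp
  show "(S + T) * R = S * R + T * R"
    by transfer (auto intro!: blinfun_eqI simp: blinfun.bilinear_simps)
  show "S * (T + R) = S * T + S * R"
    by transfer (auto intro!: blinfun_eqI simp: blinfun.bilinear_simps)
  show "r *\<^sub>R S * T = r *\<^sub>R (S * T)"
    by transfer (auto intro!: blinfun_eqI simp: blinfun.bilinear_simps)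
  show "S * r *\<^sub>R T = r *\<^sub>R (S * T)"
    by transfer (auto intro!: blinfun_eqI simp: blinfun.bilinear_simps)
  show "1 * T = T" by transfer (simp add: blinfun_eqI)
  show "T * 1 = T" by transfer (simp add: blinfun_eqI)
qed (simp add: dist_bop_def, simp add: sgn_bop_def)

end

lift_definition bapply :: "'x::real_normed_vector bop \<Rightarrow> 'x \<Rightarrow> 'x" (infixr \<open>\<rhd>\<close> 75)
  is blinfun_apply .

lift_definition bop_of :: "('x \<Rightarrow> 'x) \<Rightarrow> 'x::real_normed_vector bop" is Blinfun .

lemma bop_eqI: "(\<And>x. S \<rhd> x = T \<rhd> x) \<Longrightarrow> S = T"
  by transfer (rule blinfun_eqI)

lemma bounded_bilinear_bapply: "bounded_bilinear (\<rhd>)"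
proof
  show "\<exists>K. \<forall>(T :: 'a bop) x. norm (T \<rhd> x) \<le> norm T * norm x * K"
    by (rule exI[of _ 1], transfer) (simp add: norm_blinfun)
qed (transfer, simp add: blinfun.bilinear_simps)+

interpretation bapply: bounded_bilinear "(\<rhd>)"
  by (rule bounded_bilinear_bapply)

lemma bapply_one [simp]: "1 \<rhd> x = x"
  by transfer simp

lemma bapply_times: "(S * T) \<rhd> x = S \<rhd> T \<rhd> x"
  by transfer simp

lemmas bapply_simps = bapply_times bapply.add_left bapply.add_right bapply.diff_left
  bapply.diff_right bapply.minus_left bapply.minus_right bapply.scaleR_left
  bapply.scaleR_right bapply.zero_left bapply.zero_right

lemma norm_bapply: "norm (T \<rhd> x) \<le> norm T * norm x"
  by transfer (rule norm_blinfun)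

lemma norm_bop_bound: "0 \<le> b \<Longrightarrow> (\<And>x. norm (T \<rhd> x) \<le> b * norm x) \<Longrightarrow> norm T \<le> b"
  by transfer (rule norm_blinfun_bound)

lemma norm_bop_one: "norm (1 :: 'x::real_normed_vector bop) \<le> 1"
  by (rule norm_bop_bound) simp_all

lemma bapply_bop_of: "bounded_linear f \<Longrightarrow> bop_of f \<rhd> x = f x"
  by transfer (simp add: bounded_linear_Blinfun_apply)

instance bop :: (banach) banach
proof
  fix X :: "nat \<Rightarrow> 'a bop"
  have dist: "dist (Rep_bop S) (Rep_bop T) = dist S T" for S T :: "'a bop"
    by (simp add: dist_norm norm_bop.rep_eq minus_bop.rep_eq)
  assume "Cauchy X"
  then have "Cauchy (\<lambda>n. Rep_bop (X n))"
    unfolding Cauchy_def dist .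
  then obtain L where "(\<lambda>n. Rep_bop (X n)) \<longlonglongrightarrow> L"
    unfolding Cauchy_convergent_iff convergent_def ..
  then have "(\<lambda>n. dist (Rep_bop (X n)) (Rep_bop (Abs_bop L))) \<longlonglongrightarrow> 0"
    by (subst (asm) tendsto_dist_iff) (simp only: Abs_bop_inverse[OF UNIV_I])
  then have "X \<longlonglongrightarrow> Abs_bop L"
    unfolding dist by (subst tendsto_dist_iff)
  then show "convergent X"
    by (rule convergentI)
qed

section \<open>Square roots in Banach algebras\<close>

text \<open>
  The root is the limit of $Y_{n+1}=(K+Y_n^2)/2$. The same recursion on the real number \<open>k\<close>
  increases to $1-\sqrt{1-k}$ and dominates the increments of \<open>Y\<close>, which settles the
  boundary case \<open>k = 1\<close> as well.
\<close>

lemma banach_algebra_sqrt: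
  fixes K :: "'b::{real_normed_algebra, monoid_mult, banach}"
  assumes K: "norm K \<le> k" and k: "k \<le> 1"
  obtains Y where "norm Y \<le> 1 - sqrt (1 - k)" and "(1 - Y) * (1 - Y) = 1 - K"
    and "\<And>C. closed C \<Longrightarrow> 0 \<in> C \<Longrightarrow> (\<And>Z. Z \<in> C \<Longrightarrow> (1/2) *\<^sub>R (K + Z * Z) \<in> C) \<Longrightarrow> Y \<in> C"
proof -
  define Y where "Y = rec_nat 0 (\<lambda>_ Z. (1/2) *\<^sub>R (K + Z * Z))"
  define y where "y = rec_nat 0 (\<lambda>_ z. (k + z * z) / 2)"
  have Y0: "Y 0 = 0" and YS: "Y (Suc n) = (1/2) *\<^sub>R (K + Y n * Y n)" for n
    by (simp_all add: Y_def)
  have y0: "y 0 = 0" and yS: "y (Suc n) = (k + y n * y n) / 2" for n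
    by (simp_all add: y_def)
  define l where "l = 1 - sqrt (1 - k)"
  have k0: "0 \<le> k" using K norm_ge_zero order_trans by blast
  have l0: "0 \<le> l" using k0 k by (simp add: l_def)
  have "sqrt (1 - k) * sqrt (1 - k) = 1 - k" using k by simp
  then have "l * l = 2 * l - k" by (simp add: l_def algebra_simps)
  then have l: "(k + l * l) / 2 = l" by simp
  have y_bd: "0 \<le> y n \<and> y n \<le> l" for n
  proof (induction n)
    case (Suc n)
    then have "y n * y n \<le> l * l" by (intro mult_mono) auto
    then show ?case using Suc k0 l by (simp add: yS field_simps)
  qed (simp add: y0 l0)
  have Y_bd: "norm (Y n) \<le> y n" for n
  proof (induction n)
    case (Suc n)
    have "norm (Y n * Y n) \<le> y n * y n"
      by (rule order_trans[OF norm_mult_ineq]) (intro mult_mono Suc; simp add: y_bd)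
    then have "norm (K + Y n * Y n) \<le> k + y n * y n"
      using K norm_triangle_ineq[of K "Y n * Y n"] by linarith
    then show ?case by (simp add: YS yS)
  qed (simp add: Y0 y0)
  have incr: "norm (Y (Suc n) - Y n) \<le> y (Suc n) - y n" for n
  proof (induction n)
    case 0 then show ?case using K by (simp add: YS yS Y0 y0)
  next
    case (Suc n)
    \<comment> \<open>Z^2 - W^2 is split as Z (Z - W) + (Z - W) W, which is valid without
      commutativity; the scalar increment factors in the same way.\<close>
    have step: "(1/2) *\<^sub>R (K + Z * Z) - (1/2) *\<^sub>R (K + W * W) =
        (1/2) *\<^sub>R (Z * (Z - W) + (Z - W) * W)" for Z W
      by (simp add: right_diff_distrib left_diff_distrib flip: scaleR_diff_right)
    have "Y (Suc (Suc n)) - Y (Suc n) =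
        (1/2) *\<^sub>R (Y (Suc n) * (Y (Suc n) - Y n) + (Y (Suc n) - Y n) * Y n)"
      using step[of "Y (Suc n)" "Y n"] by (simp only: YS[symmetric])
    moreover have "norm (Y (Suc n) * (Y (Suc n) - Y n)) \<le> y (Suc n) * (y (Suc n) - y n)"
      by (rule order_trans[OF norm_mult_ineq]) (intro mult_mono Suc Y_bd; simp add: y_bd)
    moreover have "norm ((Y (Suc n) - Y n) * Y n) \<le> (y (Suc n) - y n) * y n"
    proof (rule order_trans[OF norm_mult_ineq], intro mult_mono Suc Y_bd)
      show "0 \<le> y (Suc n) - y n" using Suc norm_ge_zero order_trans by blast
    qed simp
    ultimately have "norm (Y (Suc (Suc n)) - Y (Suc n)) \<le>
        (y (Suc n) * (y (Suc n) - y n) + (y (Suc n) - y n) * y n) / 2"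
      using norm_triangle_ineq[of "Y (Suc n) * (Y (Suc n) - Y n)" "(Y (Suc n) - Y n) * Y n"]
      by simp
    also have "\<dots> = y (Suc (Suc n)) - y (Suc n)"
      by (simp add: yS[of "Suc n"] yS[of n] field_simps)
    finally show ?case .
  qed
  have incseq: "y n \<le> y (Suc n)" for n
    using incr[of n] norm_ge_zero[of "Y (Suc n) - Y n"] by linarith
  have "summable (\<lambda>n. y (Suc n) - y n)"
  proof (rule bounded_imp_summable)
    show "0 \<le> y (Suc n) - y n" for n using incseq[of n] by simp
    show "(\<Sum>k\<le>n. y (Suc k) - y k) \<le> l" for n
      using y_bd[of "Suc n"]
      by (simp add: y0 sum_lessThan_telescope flip: lessThan_Suc_atMost)
  qed
  then have "summable (\<lambda>n. Y (Suc n) - Y n)"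
    using incr by (rule summable_comparison_test'[where N = 0])
  then have "convergent Y"
    by (simp add: summable_iff_convergent sum_lessThan_telescope Y0)
  then obtain L where L: "Y \<longlonglongrightarrow> L"
    by (auto simp: convergent_def)
  have "(\<lambda>n. Y (Suc n)) \<longlonglongrightarrow> (1/2) *\<^sub>R (K + L * L)"
    unfolding YS by (intro tendsto_intros L)
  then have "L = (1/2) *\<^sub>R (K + L * L)"
    using L LIMSEQ_Suc LIMSEQ_unique by blast
  then have "2 *\<^sub>R L = 2 *\<^sub>R (1/2) *\<^sub>R (K + L * L)"
    by (rule arg_cong)
  also have "\<dots> = K + L * L"
    by simp
  finally have "2 *\<^sub>R L = K + L * L" .
  then have "L + L = K + L * L"
    by (simp only: scaleR_2)
  then have "(1 - L) * (1 - L) = 1 - K"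
    by (simp add: algebra_simps)
  moreover have "norm L \<le> l"
    using Y_bd y_bd by (intro tendsto_upperbound[OF tendsto_norm[OF L]])
      (auto intro!: always_eventually intro: order_trans)
  \<comment> \<open>The limit inherits every closed property that holds at 0 and survives the
    recursion. Self-adjointness and commutation relations reach the root in this way.\<close>
  moreover have "L \<in> C" if "closed C" "0 \<in> C"
    "\<And>Z. Z \<in> C \<Longrightarrow> (1/2) *\<^sub>R (K + Z * Z) \<in> C" for C
  proof (rule closed_sequentially[OF that(1) _ L])
    show "Y n \<in> C" for n by (induction n) (simp_all add: Y0 YS that(2,3))
  qed
  ultimately show ?thesis using that by (simp add: l_def)
qed

text \<open>A right and a left inverse arise as fixed points of the contractions Z \<mapsto> 1 + Y Z
  and Z \<mapsto> 1 + Z Y, and associativity identifies them.\<close>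

lemma banach_algebra_inverse:
  fixes Y :: "'b::{real_normed_algebra, monoid_mult, banach}"
  assumes Y: "norm Y < 1"
  obtains Z where "(1 - Y) * Z = 1" and "Z * (1 - Y) = 1"
proof -
  have "\<exists>!Z. 1 + Y * Z = Z"
  proof (rule banach_fix_type[of "norm Y"])
    have "dist (1 + Y * Z) (1 + Y * Z') \<le> norm Y * dist Z Z'" for Z Z'
      using norm_mult_ineq[of Y "Z - Z'"] by (simp add: dist_norm right_diff_distrib)
    then show "\<forall>Z Z'. dist (1 + Y * Z) (1 + Y * Z') \<le> norm Y * dist Z Z'" by blast
  qed (use Y in simp_all)
  then obtain Z where "1 + Y * Z = Z" by blast
  then have 1: "(1 - Y) * Z = 1" by (metis add_diff_cancel left_diff_distrib mult_1_left)
  have "\<exists>!Z. 1 + Z * Y = Z"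
  proof (rule banach_fix_type[of "norm Y"])
    have "dist (1 + Z * Y) (1 + Z' * Y) \<le> norm Y * dist Z Z'" for Z Z'
      using norm_mult_ineq[of "Z - Z'" Y]
      by (simp add: dist_norm left_diff_distrib mult.commute[of "norm Y"])
    then show "\<forall>Z Z'. dist (1 + Z * Y) (1 + Z' * Y) \<le> norm Y * dist Z Z'" by blast
  qed (use Y in simp_all)
  then obtain Z' where "1 + Z' * Y = Z'" by blast
  then have 2: "Z' * (1 - Y) = 1" by (metis add_diff_cancel right_diff_distrib mult_1_right)
  have "Z' = Z" using 1 2 by (metis mult.assoc mult_1_left mult_1_right)
  with 1 2 that show ?thesis by blast
qed

section \<open>Positive operators on Hilbert modules\<close>

lemma scaleC_one: "1 *\<^sub>C x = x"
  using scaleC_of_real[of 1 x] by simp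

lemma scaleC_minus_left: "(- c) *\<^sub>C x = - (c *\<^sub>C x)"
proof -
  have "(- c) *\<^sub>C x = complex_of_real (- 1) *\<^sub>C c *\<^sub>C x"
    by (simp add: scaleC_scaleC)
  then show ?thesis by (simp only: scaleC_of_real scaleR_minus1_left)
qed

context hilbert_module
begin

lemma ip_add_left: "ip (x + y) z = ip x z + ip y z"
  by (metis ip_star ip_add_right star_add)

lemma ip_scaleC_left: "ip (c *\<^sub>C x) y = cnj c *\<^sub>C ip x y"
  by (metis ip_star ip_scaleC_right star_scaleC)

lemma ip_scaleR_right: "ip x (r *\<^sub>R y) = r *\<^sub>R ip x y"
  by (simp add: ip_scaleC_right flip: scaleC_of_real)

lemma ip_scaleR_left: "ip (r *\<^sub>R x) y = r *\<^sub>R ip x y"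
  by (simp add: ip_scaleC_left flip: scaleC_of_real)

lemma linear_ip_right: "linear (ip x)"
  by (rule linearI) (simp_all add: ip_add_right ip_scaleR_right)

lemma linear_ip_left: "linear (\<lambda>x. ip x y)"
  by (rule linearI) (simp_all add: ip_add_left ip_scaleR_left)

lemmas ip_simps = ip_add_left ip_add_right ip_scaleR_left ip_scaleR_right
  linear_diff[OF linear_ip_right] linear_diff[OF linear_ip_left]
  linear_neg[OF linear_ip_right] linear_neg[OF linear_ip_left]
  linear_0[OF linear_ip_right] linear_0[OF linear_ip_left]

lemma norm_ip_self: "norm (ip x x) = (norm x)\<^sup>2"
  by (simp add: norm_eq_ip)

lemma ip_eqI:
  assumes "\<And>z. ip z x = ip z y"
  shows "x = y"
proof -
  have "ip (x - y) (x - y) = 0" using assms[of "x - y"] by (simp add: ip_simps)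
  then have "norm (x - y) = 0" by (simp add: norm_eq_ip)
  then show ?thesis by simp
qed

text \<open>A relation and not an operation, because a bounded operator on a Hilbert module may have
  no adjoint.\<close>

definition adjp :: "'x bop \<Rightarrow> 'x bop \<Rightarrow> bool" where
  "adjp C D \<longleftrightarrow> (\<forall>x y. ip (C \<rhd> x) y = ip x (D \<rhd> y))"

abbreviation sa :: "'x bop \<Rightarrow> bool" where
  "sa T \<equiv> adjp T T"

text \<open>For self-adjoint \<open>T\<close> the norm condition says that the spectrum lies in
  [0, 2t]. In this form closure under sums is just the triangle inequality.\<close>

definition posop :: "'x bop \<Rightarrow> bool" where
  "posop T \<longleftrightarrow> sa T \<and> (\<exists>t\<ge>0. norm (t *\<^sub>R 1 - T) \<le> t)"

lemma adjpD: "adjp C D \<Longrightarrow> ip (C \<rhd> x) y = ip x (D \<rhd> y)"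
  by (simp add: adjp_def)

lemma adjp_sym: "adjp C D \<Longrightarrow> adjp D C"
  unfolding adjp_def by (metis ip_star)

lemma adjp_zero: "sa 0"
  by (simp add: adjp_def bapply_simps ip_simps)

lemma adjp_one: "sa 1"
  by (simp add: adjp_def)

lemma adjp_add: "adjp C D \<Longrightarrow> adjp C' D' \<Longrightarrow> adjp (C + C') (D + D')"
  by (simp add: adjp_def bapply_simps ip_simps)

lemma adjp_diff: "adjp C D \<Longrightarrow> adjp C' D' \<Longrightarrow> adjp (C - C') (D - D')"
  by (simp add: adjp_def bapply_simps ip_simps)

lemma adjp_minus: "adjp C D \<Longrightarrow> adjp (- C) (- D)"
  by (simp add: adjp_def bapply_simps ip_simps)

lemma adjp_scaleR: "adjp C D \<Longrightarrow> adjp (r *\<^sub>R C) (r *\<^sub>R D)"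
  by (simp add: adjp_def bapply_simps ip_simps)

lemma adjp_times: "adjp C D \<Longrightarrow> adjp C' D' \<Longrightarrow> adjp (C * C') (D' * D)"
  by (simp add: adjp_def bapply_simps)

lemma sa_times: "sa S \<Longrightarrow> sa T \<Longrightarrow> S * T = T * S \<Longrightarrow> sa (S * T)"
  using adjp_times by metis

lemmas adjp_intros = adjp_zero adjp_one adjp_add adjp_diff adjp_minus adjp_scaleR adjp_times

lemma posop_sa: "posop T \<Longrightarrow> sa T"
  by (simp add: posop_def)

lemma posop_add:
  assumes "posop S" "posop T"
  shows "posop (S + T)"
proof -
  obtain s t where "0 \<le> s" "norm (s *\<^sub>R 1 - S) \<le> s" "0 \<le> t" "norm (t *\<^sub>R 1 - T) \<le> t"
    using assms by (auto simp: posop_def)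
  moreover have eq: "(s + t) *\<^sub>R 1 - (S + T) = (s *\<^sub>R 1 - S) + (t *\<^sub>R 1 - T)"
    by (simp add: algebra_simps)
  ultimately have "norm ((s + t) *\<^sub>R 1 - (S + T)) \<le> s + t" "0 \<le> s + t"
    unfolding eq using norm_triangle_ineq[of "s *\<^sub>R 1 - S" "t *\<^sub>R 1 - T"] by linarith+
  moreover have "sa (S + T)" using assms by (simp add: posop_def adjp_add)
  ultimately show ?thesis unfolding posop_def by blast
qed

lemma posop_scaleR:
  assumes "posop T" "0 \<le> r"
  shows "posop (r *\<^sub>R T)"
proof -
  obtain t where t: "0 \<le> t" "norm (t *\<^sub>R 1 - T) \<le> t"
    using assms by (auto simp: posop_def)
  have "(r * t) *\<^sub>R 1 - r *\<^sub>R T = r *\<^sub>R (t *\<^sub>R 1 - T)"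
    by (simp add: scaleR_diff_right)
  then have "norm ((r * t) *\<^sub>R 1 - r *\<^sub>R T) \<le> r * t"
    using t assms(2) by (simp add: mult_left_mono)
  moreover have "0 \<le> r * t" using t assms(2) by simp
  ultimately show ?thesis
    using assms unfolding posop_def by (blast intro: adjp_scaleR)
qed

text \<open>Both $g\pm ia$ are $\sqrt s$ times an isometry, and \<open>g\<close> is their mean.\<close>

lemma norm_sa_le_of_sum_squares:
  assumes g: "sa g" and a: "sa a" and comm: "g * a = a * g"
    and s: "g * g + a * a = s *\<^sub>R 1" "0 \<le> s"
  shows "norm g \<le> sqrt s"
proof (rule norm_bop_bound)
  fix x
  define u w where "u = g \<rhd> x" and "w = \<i> *\<^sub>C (a \<rhd> x)"
  have "ip (g \<rhd> x) (a \<rhd> x) = ip x ((g * a) \<rhd> x)"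
    by (simp add: adjpD[OF g] bapply_times)
  also have "\<dots> = ip (a \<rhd> x) (g \<rhd> x)"
    by (simp add: adjpD[OF a] bapply_times comm)
  \<comment> \<open>By commutation the inner products of g x and a x agree in either order, so the
    factors \<i> and -\<i> make them cancel.\<close>
  finally have cross: "ip u w + ip w u = 0"
    by (simp add: u_def w_def ip_scaleC_right ip_scaleC_left flip: scaleC_add_left)
      (metis norm_eq_zero norm_scaleC norm_zero mult_zero_left)
  have "ip u u + ip w w = ip (g \<rhd> x) (g \<rhd> x) + ip (a \<rhd> x) (a \<rhd> x)"
    by (simp add: u_def w_def ip_scaleC_right ip_scaleC_left scaleC_scaleC)
      (metis scaleC_of_real of_real_1 scaleR_one)
  also have "\<dots> = ip x ((g * g + a * a) \<rhd> x)"
    by (simp add: adjpD[OF g] adjpD[OF a] bapply_simps ip_simps)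
  also have "\<dots> = s *\<^sub>R ip x x"
    by (simp add: s bapply_simps ip_simps)
  finally have diag: "ip u u + ip w w = s *\<^sub>R ip x x" .
  have "ip (u + w) (u + w) = s *\<^sub>R ip x x + (ip u w + ip w u)"
    unfolding diag[symmetric] by (simp add: ip_simps algebra_simps)
  then have "norm (u + w) = sqrt s * norm x"
    using s(2) cross by (simp add: norm_eq_ip real_sqrt_mult)
  moreover have "ip (u - w) (u - w) = s *\<^sub>R ip x x + - (ip u w + ip w u)"
    unfolding diag[symmetric] by (simp add: ip_simps algebra_simps)
  then have "norm (u - w) = sqrt s * norm x"
    using s(2) cross by (simp add: norm_eq_ip real_sqrt_mult)
  moreover have "2 *\<^sub>R u = (u + w) + (u - w)"
    by (simp add: scaleR_2)
  then have "2 * norm u \<le> norm (u + w) + norm (u - w)"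
    using norm_triangle_ineq[of "u + w" "u - w"] by (metis norm_scaleR abs_numeral)
  ultimately show "norm (g \<rhd> x) \<le> sqrt s * norm x"
    by (simp add: u_def)
qed (use s in simp)

end

text \<open>
  The Cauchy--Schwarz inequality holds in every Hilbert module, but its proof needs that
  $b^*b$ is a positive operator on the algebra. For the algebra as a module over itself it is just
  submultiplicativity of the norm.
\<close>

locale hilbert_cs = hilbert_module act ip
  for act :: "'x::complex_banach \<Rightarrow> 'a::cstar_algebra \<Rightarrow> 'x" and ip +
  assumes cauchy_schwarz: "norm (ip x y) \<le> norm x * norm y"
begin

lemma bounded_bilinear_ip: "bounded_bilinear ip"
proof
  show "\<exists>K. \<forall>x y. norm (ip x y) \<le> norm x * norm y * K"
    using cauchy_schwarz by (intro exI[of _ 1]) simp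
qed (simp_all add: ip_simps)

lemma norm_square_le:
  assumes "adjp C D"
  shows "(norm C)\<^sup>2 \<le> norm (D * C)"
proof -
  have "norm C \<le> sqrt (norm (D * C))"
  proof (rule norm_bop_bound)
    fix x
    have "(norm (C \<rhd> x))\<^sup>2 = norm (ip x ((D * C) \<rhd> x))"
      using norm_ip_self[of "C \<rhd> x"] by (simp add: adjpD[OF assms] bapply_times)
    also have "\<dots> \<le> norm x * norm ((D * C) \<rhd> x)"
      by (rule cauchy_schwarz)
    also have "\<dots> \<le> norm x * (norm (D * C) * norm x)"
      by (intro mult_left_mono norm_bapply) simp
    finally have "(norm (C \<rhd> x))\<^sup>2 \<le> (sqrt (norm (D * C)) * norm x)\<^sup>2"
      by (simp add: power_mult_distrib power2_eq_square mult_ac)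
    then show "norm (C \<rhd> x) \<le> sqrt (norm (D * C)) * norm x"
      by (rule power2_le_imp_le) simp
  qed simp
  then show ?thesis
    using power_mono[of "norm C" "sqrt (norm (D * C))" 2] by simp
qed

section \<open>Self-adjoint square roots\<close>

lemma closed_sa: "closed {T. sa T}"
proof -
  interpret ip: bounded_bilinear ip by (rule bounded_bilinear_ip)
  show ?thesis
    unfolding adjp_def
    by (intro closed_Collect_all closed_Collect_eq ip.continuous_on bapply.continuous_on
        continuous_intros)
qed

lemma closed_commutant: "closed {T :: 'x bop. Z * T = T * Z}"
  by (intro closed_Collect_eq continuous_intros)

lemma sa_sqrt_closed:
  assumes "sa K" "norm K \<le> k" "k \<le> 1"
  obtains Y where "sa Y" "norm Y \<le> 1 - sqrt (1 - k)" "(1 - Y) * (1 - Y) = 1 - K"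
    "\<And>C. closed C \<Longrightarrow> 0 \<in> C \<Longrightarrow> (\<And>Z. Z \<in> C \<Longrightarrow> (1/2) *\<^sub>R (K + Z * Z) \<in> C) \<Longrightarrow> Y \<in> C"
proof (rule banach_algebra_sqrt[OF assms(2,3)])
  fix Y
  assume Y: "norm Y \<le> 1 - sqrt (1 - k)" "(1 - Y) * (1 - Y) = 1 - K"
    "\<And>C. closed C \<Longrightarrow> 0 \<in> C \<Longrightarrow> (\<And>Z. Z \<in> C \<Longrightarrow> (1/2) *\<^sub>R (K + Z * Z) \<in> C) \<Longrightarrow> Y \<in> C"
  have "Y \<in> {T. sa T}"
    by (rule Y(3)[OF closed_sa]) (use assms(1) in \<open>auto intro: adjp_intros\<close>)
  with Y show thesis by (intro that[of Y]) auto
qed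

text \<open>Commutation with a fixed \<open>Z\<close> is closed and survives the recursion, so it
  passes from \<open>K\<close> to the root. Arguments that combine two roots depend on this.\<close>

lemma sa_sqrt:
  assumes "sa K" "norm K \<le> k" "k \<le> 1"
  obtains Y where "sa Y" "norm Y \<le> 1 - sqrt (1 - k)" "(1 - Y) * (1 - Y) = 1 - K"
    "\<And>Z. Z * K = K * Z \<Longrightarrow> Z * Y = Y * Z"
proof (rule sa_sqrt_closed[OF assms])
  fix Y
  assume Y: "sa Y" "norm Y \<le> 1 - sqrt (1 - k)" "(1 - Y) * (1 - Y) = 1 - K"
    "\<And>C. closed C \<Longrightarrow> 0 \<in> C \<Longrightarrow> (\<And>Z. Z \<in> C \<Longrightarrow> (1/2) *\<^sub>R (K + Z * Z) \<in> C) \<Longrightarrow> Y \<in> C"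
  have "Y \<in> {T. Z * T = T * Z}" if "Z * K = K * Z" for Z
  proof (rule Y(4)[OF closed_commutant])
    fix W assume "W \<in> {T. Z * T = T * Z}"
    then have W: "Z * W = W * Z" by simp
    have "Z * (W * W) = W * W * Z"
      by (metis W mult.assoc)
    then show "(1/2) *\<^sub>R (K + W * W) \<in> {T. Z * T = T * Z}"
      using that by (simp add: distrib_left distrib_right)
  qed simp
  with Y(1-3) show thesis by (intro that[of Y]) auto
qed

text \<open>Dividing by t turns the norm condition into P = t (1 - K) with norm K \<le> 1, and t = 0
  forces P = 0. The root sqrt t (1 - Y) differs from sqrt t by at most sqrt t, hence is positive
  again.\<close>

lemma posop_sqrt:
  assumes "posop P"
  obtains p where "posop p" "p * p = P" "\<And>Z. Z * P = P * Z \<Longrightarrow> Z * p = p * Z"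
proof -
  obtain t where t0: "0 \<le> t" "norm (t *\<^sub>R 1 - P) \<le> t" and P: "sa P"
    using assms by (auto simp: posop_def)
  show ?thesis
  proof (cases "t = 0")
    case True
    then have "P = 0" using t0 by simp
    then show ?thesis using assms that[of 0] by simp
  next
    case False
    then have t: "0 < t" using t0 by simp
    define K where "K = 1 - (1/t) *\<^sub>R P"
    have tK: "t *\<^sub>R K = t *\<^sub>R 1 - P" using t by (simp add: K_def scaleR_diff_right)
    then have "t * norm K \<le> t" using t0 by (metis norm_scaleR abs_of_nonneg)
    then have K1: "norm K \<le> 1" using t by simp
    have saK: "sa K" unfolding K_def by (intro adjp_intros P)
    obtain Y where Y: "sa Y" "norm Y \<le> 1 - sqrt (1 - 1)" "(1 - Y) * (1 - Y) = 1 - K"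
      "\<And>Z. Z * K = K * Z \<Longrightarrow> Z * Y = Y * Z"
      by (rule sa_sqrt[OF saK K1 order_refl]) (rule that)
    define p where "p = sqrt t *\<^sub>R (1 - Y)"
    have "p * p = t *\<^sub>R (1 - K)"
      using t by (simp add: p_def Y(3))
    also have "\<dots> = P" using t by (simp add: K_def)
    finally have pp: "p * p = P" .
    have "norm (sqrt t *\<^sub>R 1 - p) = norm (sqrt t *\<^sub>R Y)"
      by (simp add: p_def scaleR_diff_right)
    also have "\<dots> \<le> sqrt t" using Y(2) t by simp
    finally have "posop p"
      unfolding posop_def using t Y(1)
      by (auto simp: p_def intro!: adjp_intros exI[of _ "sqrt t"])
    moreover have "Z * p = p * Z" if "Z * P = P * Z" for Z
    proof -
      have "Z * K = K * Z" using that by (simp add: K_def algebra_simps)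
      then show ?thesis using Y(4) by (simp add: p_def algebra_simps)
    qed
    ultimately show ?thesis using that pp by blast
  qed
qed

text \<open>After rescaling a to b, the root 1 - Y of 1 - b^2 commutes with b and the two squares
  sum to 1. The bound for sums of squares gives norm (1 - Y) \<le> 1 and so norm (1 - b^2) \<le>
  1.\<close>

lemma posop_square:
  assumes a: "sa a"
  shows "posop (a * a)"
proof -
  \<comment> \<open>The added 1 keeps t positive when a = 0.\<close>
  define t where "t = (norm a)\<^sup>2 + 1"
  have t: "0 < t" by (simp add: t_def add_nonneg_pos)
  define b where "b = (1 / sqrt t) *\<^sub>R a"
  have bb: "b * b = (1/t) *\<^sub>R (a * a)" using t by (simp add: b_def)
  have b: "sa b" unfolding b_def by (intro adjp_intros a)
  have "norm (a * a) \<le> t"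
    using norm_mult_ineq[of a a] by (simp add: t_def power2_eq_square)
  then have bb1: "norm (b * b) \<le> 1" using t by (simp add: bb)
  obtain Y where Y: "sa Y" "norm Y \<le> 1 - sqrt (1 - 1)"
      "(1 - Y) * (1 - Y) = 1 - b * b" "\<And>Z. Z * (b * b) = b * b * Z \<Longrightarrow> Z * Y = Y * Z"
    by (rule sa_sqrt[OF adjp_times[OF b b] bb1 order_refl]) (rule that)
  have "b * Y = Y * b" by (rule Y(4)) (simp add: mult.assoc)
  then have "(1 - Y) * b = b * (1 - Y)" by (simp add: algebra_simps)
  moreover have "(1 - Y) * (1 - Y) + b * b = 1 *\<^sub>R 1" by (simp add: Y(3))
  ultimately have "norm (1 - Y) \<le> 1"
    using norm_sa_le_of_sum_squares[of "1 - Y" b 1] Y(1) b by (auto intro: adjp_intros)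
  then have "norm ((1 - Y) * (1 - Y)) \<le> 1"
    using norm_mult_ineq[of "1 - Y" "1 - Y"] mult_mono[of "norm (1 - Y)" 1 "norm (1 - Y)" 1]
    by simp
  moreover have "t *\<^sub>R 1 - a * a = t *\<^sub>R ((1 - Y) * (1 - Y))"
    using t by (simp add: Y(3) bb scaleR_diff_right)
  ultimately have "norm (t *\<^sub>R 1 - a * a) \<le> t" using t by simp
  then show ?thesis
    unfolding posop_def using t a by (auto intro!: adjp_intros exI[of _ t])
qed

text \<open>The roots of P and of -P commute and their squares sum to 0, so the bound for sums of
  squares applies with s = 0.\<close>

lemma posop_antisym:
  assumes "posop P" "posop (- P)"
  shows "P = 0"
proof -
  obtain p where p: "posop p" "p * p = P" "\<And>Z. Z * P = P * Z \<Longrightarrow> Z * p = p * Z"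
    using posop_sqrt[OF assms(1)] by blast
  obtain q where q: "posop q" "q * q = - P" "\<And>Z. Z * (- P) = (- P) * Z \<Longrightarrow> Z * q = q * Z"
    using posop_sqrt[OF assms(2)] by blast
  have "p * q = q * p"
    by (rule q(3)) (simp add: p(2)[symmetric] mult.assoc)
  moreover have "p * p + q * q = 0 *\<^sub>R 1" by (simp add: p q)
  ultimately have "norm p \<le> sqrt 0"
    using norm_sa_le_of_sum_squares[of p q 0] p(1) q(1) by (simp add: posop_sa)
  then have "p = 0" by simp
  then show ?thesis using p(2) by simp
qed

section \<open>Positivity of C* C\<close>

lemma norm_sa_power2:
  assumes "sa H"
  shows "norm H ^ (2 ^ j) \<le> norm (H ^ (2 ^ j))"
proof -
  have "sa (H ^ n)" for n
    by (induction n) (auto intro: adjp_intros simp: power_commutes intro!: sa_times assms)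
  then have step: "(norm (H ^ n))\<^sup>2 \<le> norm (H ^ (2 * n))" for n
    using norm_square_le[of "H ^ n" "H ^ n"] by (simp add: mult_2 power_add)
  show ?thesis
  proof (induction j)
    case (Suc j)
    have "norm H ^ (2 ^ Suc j) = (norm H ^ (2 ^ j))\<^sup>2"
      by (simp add: power_mult[symmetric] mult.commute)
    also have "\<dots> \<le> (norm (H ^ (2 ^ j)))\<^sup>2"
      by (intro power_mono Suc) simp
    also have "\<dots> \<le> norm (H ^ (2 ^ Suc j))"
      using step[of "2 ^ j"] by simp
    finally show ?case .
  qed simp
qed

text \<open>
  This replaces the equality of the nonzero spectra of \<open>CD\<close> and \<open>DC\<close>: the powers of
  \<open>t + CD\<close> are controlled by those of \<open>t + DC\<close> up to a linear factor, which the
  exact growth of the powers of a self-adjoint operator does not see.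
\<close>

lemma posop_swap:
  assumes CD: "adjp C D" and "posop (- (D * C))"
  shows "posop (- (C * D))"
proof -
  obtain t0 where t0: "0 \<le> t0" "norm (t0 *\<^sub>R 1 + D * C) \<le> t0"
    using assms(2) by (auto simp: posop_def)
  define t where "t = t0 + 1"
  have t: "0 < t" using t0 by (simp add: t_def)
  define G H where "G = t *\<^sub>R 1 + D * C" and "H = t *\<^sub>R 1 + C * D"
  have "G = 1 + (t0 *\<^sub>R 1 + D * C)" by (simp add: G_def t_def algebra_simps)
  then have G: "norm G \<le> t"
    using norm_triangle_ineq[of 1 "t0 *\<^sub>R 1 + D * C"] t0 norm_bop_one[where 'x = 'x]
    by (simp add: t_def)
  have saH: "sa H" unfolding H_def using CD adjp_sym[OF CD] by (intro adjp_intros)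
  have intertwine: "H ^ n * C = C * G ^ n" for n
  proof (induction n)
    case (Suc n)
    have "H * C = C * G" by (simp add: G_def H_def algebra_simps)
    then show ?case using Suc by (metis mult.assoc power_Suc2)
  qed simp
  have Gn: "norm (G ^ n) \<le> t ^ n" for n
  proof (induction n)
    case (Suc n)
    then show ?case
      using norm_mult_ineq[of G "G ^ n"] mult_mono[OF G Suc] t by simp
  qed (simp add: norm_bop_one)
  define m where "m = norm C * norm D / t"
  have m: "0 \<le> m" using t by (simp add: m_def)
  have Hn: "norm (H ^ n) \<le> t ^ n * (1 + n * m)" for n
  proof (induction n)
    case (Suc n)
    \<comment> \<open>Splitting the last factor H = t + C D and pulling C through the powers of H
      leaves t H^n plus C G^n D. Each step thus adds at most norm C norm D t^n, which is m
      t^(n+1).\<close>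
    have "H ^ Suc n = t *\<^sub>R H ^ n + H ^ n * C * D"
      by (simp only: power_Suc2) (simp add: H_def algebra_simps)
    then have "norm (H ^ Suc n) \<le> t * norm (H ^ n) + norm (C * G ^ n * D)"
      using norm_triangle_ineq[of "t *\<^sub>R H ^ n" "H ^ n * C * D"] t by (simp add: intertwine)
    also have "norm (C * G ^ n * D) \<le> norm C * norm (G ^ n) * norm D"
      by (meson mult_right_mono norm_ge_zero norm_mult_ineq order_trans)
    also have "\<dots> \<le> norm C * t ^ n * norm D"
      by (intro mult_mono mult_left_mono Gn) (use t in auto)
    also have "t * norm (H ^ n) \<le> t * (t ^ n * (1 + n * m))"
      using Suc t by simp
    also have "t * (t ^ n * (1 + n * m)) + norm C * t ^ n * norm D = t ^ Suc n * (1 + Suc n * m)"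
      using t by (simp add: m_def field_simps)
    finally show ?case by simp
  qed (simp add: norm_bop_one)
  have "norm H \<le> t"
  proof (rule ccontr)
    assume "\<not> norm H \<le> t"
    define r where "r = norm H / t"
    have r: "1 < r" using \<open>\<not> norm H \<le> t\<close> t by (simp add: r_def)
    have le: "r ^ (2 ^ j) \<le> 1 + (2 ^ j) * m" for j :: nat
    proof -
      have "norm H ^ (2 ^ j) \<le> t ^ (2 ^ j) * (1 + (2 ^ j) * m)"
        using order_trans[OF norm_sa_power2[OF saH, of j] Hn[of "2 ^ j"]] by simp
      then show ?thesis
        using t by (simp add: r_def power_divide field_simps)
    qed
    have "(\<lambda>n. (1 + real n * m) / r ^ n) \<longlonglongrightarrow> 0"
      using r by real_asymp
    then have "eventually (\<lambda>n. (1 + real n * m) / r ^ n < 1) sequentially"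
      by (rule order_tendstoD) simp
    then obtain N where N: "\<And>n. n \<ge> N \<Longrightarrow> (1 + real n * m) / r ^ n < 1"
      by (auto simp: eventually_sequentially)
    \<comment> \<open>The bound \<open>le\<close> is available at exponents 2^j only; N \<le> 2^N
      places one of them beyond the threshold.\<close>
    have "(1 + real (2 ^ N) * m) / r ^ (2 ^ N) < 1"
      by (rule N) (simp add: less_imp_le)
    then have "1 + 2 ^ N * m < r ^ (2 ^ N)"
      using r by (simp add: field_simps)
    then show False using le[of N] by simp
  qed
  then have "norm (t *\<^sub>R 1 - - (C * D)) \<le> t" by (simp add: H_def)
  then show ?thesis
    unfolding posop_def using CD adjp_sym[OF CD] t
    by (auto intro!: adjp_intros exI[of _ t])
qed

text \<open>
  Kaplansky's argument. For $a = D C = C^* C$ and \<open>n = \<bar>a\<bar> - a\<close>, twice the negative part of \<open>a\<close>,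
  the operator \<open>E = C n\<close> has $-E^*E = n|a|n \ge 0$, hence $-EE^*\ge 0$ as well, while
  $E^*E+EE^*$ is a sum of two squares.
\<close>

theorem posop_adjoint_times:
  assumes CD: "adjp C D"
  shows "posop (D * C)"
proof -
  have DC: "adjp D C" by (rule adjp_sym[OF CD])
  define a where "a = D * C"
  have a: "sa a" unfolding a_def by (intro adjp_intros CD DC)
  obtain h where h: "posop h" "h * h = a * a" "\<And>Z. Z * (a * a) = (a * a) * Z \<Longrightarrow> Z * h = h * Z"
    using posop_sqrt[OF posop_square[OF a]] by blast
  \<comment> \<open>A further root k of h = |a| is taken so that n h n becomes the square of the
    self-adjoint operator k n.\<close>
  obtain k where k: "posop k" "k * k = h" "\<And>Z. Z * h = h * Z \<Longrightarrow> Z * k = k * Z"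
    using posop_sqrt[OF h(1)] by blast
  have ah: "a * h = h * a" by (rule h(3)) (simp add: mult.assoc)
  have ak: "a * k = k * a" by (rule k(3)) (rule ah)
  have kh: "h * k = k * h" by (simp add: k(2)[symmetric] mult.assoc)
  define n where "n = h - a"
  have n: "sa n" unfolding n_def by (rule adjp_diff[OF posop_sa[OF h(1)] a])
  have nk: "n * k = k * n" by (simp add: n_def algebra_simps ak kh)
  have nh: "n * h = h * n" by (simp add: n_def algebra_simps ah)
  have an: "a * n = - (h * n)" by (simp add: n_def algebra_simps ah h(2))
  define E F where "E = C * n" and "F = n * D"
  have EF: "adjp E F" and FE: "adjp F E"
    unfolding E_def F_def by (intro adjp_intros CD DC n)+
  have "F * E = n * (a * n)" by (simp add: E_def F_def a_def mult.assoc)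
  also have "\<dots> = - (k * n * (k * n))"
    unfolding an k(2)[symmetric] by (simp add: mult.assoc) (metis mult.assoc nk)
  finally have FE_neg: "- (F * E) = k * n * (k * n)" by simp
  have sakn: "sa (k * n)" by (rule sa_times[OF posop_sa[OF k(1)] n nk[symmetric]])
  have "posop (- (F * E))" unfolding FE_neg by (rule posop_square[OF sakn])
  then have negEF: "posop (- (E * F))" by (rule posop_swap[OF EF])
  \<comment> \<open>Elements of \<open>bop\<close> are only real linear, so multiplication by \<i>
    enters as an operator J. It commutes with every adjointable operator because these are complex
    linear.\<close>
  define J :: "'x bop" where "J = bop_of (scaleC \<i>)"
  have "bounded_linear (scaleC \<i> :: 'x \<Rightarrow> 'x)"
  proof (rule bounded_linear_intro[where K = 1])
    show "\<i> *\<^sub>C (r *\<^sub>R x) = r *\<^sub>R (\<i> *\<^sub>C x)" for r and x :: 'x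
      by (simp add: scaleC_scaleC mult.commute flip: scaleC_of_real)
  qed (simp_all add: scaleC_add_right norm_scaleC)
  then have J: "J \<rhd> x = \<i> *\<^sub>C x" for x unfolding J_def by (rule bapply_bop_of)
  have J_adj: "adjp J (- J)"
    unfolding adjp_def
    by (simp add: J ip_scaleC_left ip_scaleC_right bapply_simps ip_simps scaleC_minus_left)
  have J_comm: "J * S = S * J" if "adjp S S'" for S S'
  proof (rule bop_eqI, rule ip_eqI)
    fix x z
    have "adjp S' S" by (rule adjp_sym[OF that])
    then show "ip z ((J * S) \<rhd> x) = ip z ((S * J) \<rhd> x)"
      by (simp add: bapply_times J ip_scaleC_right flip: adjpD)
  qed
  have JJ: "J * J = - 1"
    by (rule bop_eqI) (simp add: bapply_simps J scaleC_scaleC scaleC_minus_left scaleC_one)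
  \<comment> \<open>E + F and y are twice the real part and, up to sign, twice the imaginary part of
    E, so their squares sum to 2 (E F + F E).\<close>
  define y where "y = J * (E - F)"
  have y: "sa y"
  proof -
    have "adjp y ((F - E) * - J)" unfolding y_def by (intro adjp_intros EF FE J_adj)
    moreover have "(F - E) * - J = y"
      using J_comm[of "E - F" "F - E"] EF FE by (simp add: y_def adjp_intros algebra_simps)
    ultimately show ?thesis by simp
  qed
  have "y * y = J * J * ((E - F) * (E - F))"
    using J_comm[of "E - F" "F - E"] EF FE unfolding y_def
    by (simp add: adjp_intros) (metis mult.assoc)
  then have yy: "y * y = - ((E - F) * (E - F))" by (simp add: JJ)
  have "posop ((1/2) *\<^sub>R ((E + F) * (E + F) + y * y))"
    using adjp_add[OF EF FE] y
    by (intro posop_scaleR posop_add posop_square) (simp_all add: add.commute)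
  moreover have "(E + F) * (E + F) + y * y = 2 *\<^sub>R (E * F + F * E)"
    by (simp add: yy algebra_simps scaleR_2)
  ultimately have "posop (E * F + F * E)" by simp
  from posop_add[OF this negEF] have "posop (F * E)" by simp
  then have "F * E = 0"
    using \<open>posop (- (F * E))\<close> by (rule posop_antisym)
  have sa_square_zero: "S = 0" if "sa S" "S * S = 0" for S
    using norm_square_le[OF that(1)] that(2) by simp
  \<comment> \<open>The self-adjoint k n has square 0. Then n^2 = h n - a n = 2 h n vanishes as
    well, which leaves a = h.\<close>
  have "k * n = 0"
    by (rule sa_square_zero[OF sakn]) (use FE_neg \<open>F * E = 0\<close> in simp)
  then have "h * n = 0" by (simp add: k(2)[symmetric] mult.assoc)
  moreover have "n * n = h * n - a * n" by (simp add: n_def algebra_simps)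
  ultimately have "n * n = 0" using an by simp
  then have "n = 0" by (rule sa_square_zero[OF n])
  then have "a = h" by (simp add: n_def)
  then show ?thesis using h(1) by (simp add: a_def)
qed

text \<open>Put s = norm (P + Q). Then s - P is the sum of the positive operators s - (P + Q) and Q;
  its root commutes with that of P and their squares sum to s.\<close>

lemma norm_posop_mono:
  assumes P: "posop P" and Q: "posop Q"
  shows "norm P \<le> norm (P + Q)"
proof (cases "norm (P + Q) = 0")
  case True
  then have "Q = - P" by (simp add: eq_neg_iff_add_eq_0 add.commute)
  then have "P = 0" using posop_antisym P Q by simp
  then show ?thesis by simp
next
  case False
  define s where "s = norm (P + Q)"
  have s: "0 < s" using False by (simp add: s_def)
  define K where "K = (1/s) *\<^sub>R (P + Q)"
  have K: "norm K \<le> 1" using s by (simp add: K_def s_def)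
  have saK: "sa K" unfolding K_def by (intro adjp_intros posop_sa P Q)
  obtain Y where Y: "sa Y" "norm Y \<le> 1 - sqrt (1 - 1)" "(1 - Y) * (1 - Y) = 1 - K"
    by (rule sa_sqrt[OF saK K order_refl]) (rule that)
  have "posop (s *\<^sub>R ((1 - Y) * (1 - Y)) + Q)"
    using s Y(1) by (intro posop_add posop_scaleR posop_square adjp_intros Q) simp_all
  moreover have "s *\<^sub>R ((1 - Y) * (1 - Y)) + Q = s *\<^sub>R 1 - P"
    unfolding Y(3) K_def using s by (simp add: algebra_simps)
  ultimately have "posop (s *\<^sub>R 1 - P)" by simp
  then obtain q where q: "posop q" "q * q = s *\<^sub>R 1 - P"
    "\<And>Z. Z * (s *\<^sub>R 1 - P) = (s *\<^sub>R 1 - P) * Z \<Longrightarrow> Z * q = q * Z"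
    using posop_sqrt by blast
  obtain p where p: "posop p" "p * p = P" "\<And>Z. Z * P = P * Z \<Longrightarrow> Z * p = p * Z"
    using posop_sqrt[OF P] by blast
  have "p * q = q * p"
    by (rule q(3)) (simp add: p(2)[symmetric] algebra_simps)
  moreover have "p * p + q * q = s *\<^sub>R 1" by (simp add: p q)
  ultimately have "norm p \<le> sqrt s"
    using norm_sa_le_of_sum_squares[of p q s] p(1) q(1) s by (simp add: posop_sa)
  then have "norm p * norm p \<le> sqrt s * sqrt s" by (intro mult_mono) (use s in auto)
  then show ?thesis
    using norm_mult_ineq[of p p] s by (simp add: p s_def)
qed

text \<open>In the identity (P - c)^2 + P (2c - P) = c^2 the second term is the square of p q, with
  p and q commuting roots of P and 2c - P.\<close>

lemma norm_posop_diff_le: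
  assumes P: "posop P" and c: "norm P \<le> 2 * c"
  shows "norm (P - c *\<^sub>R 1) \<le> c"
proof (cases "c = 0")
  case False
  have "0 \<le> 2 * c" using c norm_ge_zero order_trans by blast
  then have c0: "0 < c" using False by simp
  define K where "K = (1 / (2 * c)) *\<^sub>R P"
  have K: "norm K \<le> 1" using c c0 by (simp add: K_def)
  have saK: "sa K" unfolding K_def by (intro adjp_intros posop_sa P)
  obtain Y where Y: "sa Y" "norm Y \<le> 1 - sqrt (1 - 1)" "(1 - Y) * (1 - Y) = 1 - K"
    "\<And>Z. Z * K = K * Z \<Longrightarrow> Z * Y = Y * Z"
    by (rule sa_sqrt[OF saK K order_refl]) (rule that)
  obtain p where p: "posop p" "p * p = P" "\<And>Z. Z * P = P * Z \<Longrightarrow> Z * p = p * Z"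
    using posop_sqrt[OF P] by blast
  define q where "q = sqrt (2 * c) *\<^sub>R (1 - Y)"
  have qq: "q * q = (2 * c) *\<^sub>R 1 - P"
    using c0 by (simp add: q_def Y(3)) (simp add: K_def scaleR_diff_right)
  have q: "sa q" unfolding q_def by (intro adjp_intros Y)
  have "p * K = K * p" by (simp add: K_def p(2)[symmetric] mult.assoc)
  then have pq: "p * q = q * p" using Y(4) by (simp add: q_def algebra_simps)
  have Pq: "P * q = q * P" by (metis p(2) pq mult.assoc)
  have "(p * q) * (p * q) = P * (q * q)"
    by (metis p(2) pq mult.assoc)
  also have "\<dots> = (2 * c) *\<^sub>R P - P * P" by (simp add: qq algebra_simps)
  finally have "(P - c *\<^sub>R 1) * (P - c *\<^sub>R 1) + (p * q) * (p * q) = (c * c) *\<^sub>R 1"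
    by (simp add: algebra_simps) (simp add: scaleR_add_left[symmetric])
  moreover have "(P - c *\<^sub>R 1) * (p * q) = (p * q) * (P - c *\<^sub>R 1)"
    by (simp add: algebra_simps) (metis p(2) Pq mult.assoc)
  moreover have "sa (P - c *\<^sub>R 1)" "sa (p * q)"
    by (intro adjp_intros posop_sa[OF P]) (rule sa_times[OF posop_sa[OF p(1)] q pq])
  ultimately have "norm (P - c *\<^sub>R 1) \<le> sqrt (c * c)"
    by (intro norm_sa_le_of_sum_squares) auto
  then show ?thesis using c0 by simp
qed (use c in simp)

end

section \<open>Positive elements and the Cauchy--Schwarz inequality\<close>

lemma norm_star: "norm (star a) = norm (a :: 'a::cstar_algebra)"
proof -
  have le: "norm b \<le> norm (star b)" for b :: 'a
  proof (cases "b = 0")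
    case False
    have "norm b * norm b \<le> norm (star b) * norm b"
      using norm_mult_ineq[of "star b" b] by (simp add: cstar_identity power2_eq_square)
    then show ?thesis using False by simp
  qed simp
  show ?thesis using le[of a] le[of "star a"] by (simp add: star_star)
qed

interpretation alg: hilbert_cs "(*) :: 'a::cstar_algebra \<Rightarrow> 'a \<Rightarrow> 'a" "\<lambda>a b. star a * b"
proof
  fix a b :: 'a
  show "cstar_pos (star a * a)" unfolding cstar_pos_def by blast
  show "norm (star a * b) \<le> norm a * norm b"
    using norm_mult_ineq[of "star a" b] by (simp add: norm_star)
  show "norm a = sqrt (norm (star a * a))" by (simp add: cstar_identity)
qed (simp_all add: distrib_left distrib_right mult_scaleC_left mult_scaleC_right mult.assoc
    star_mult star_star)

lemma star_scaleR: "star (r *\<^sub>R a) = r *\<^sub>R star (a :: 'a::cstar_algebra)"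
  using star_scaleC[of "of_real r" a] by (simp add: scaleC_of_real)

lemma linear_star: "linear (star :: 'a::cstar_algebra \<Rightarrow> 'a)"
  by (rule linearI) (simp_all add: star_add star_scaleR)

lemma bounded_linear_star: "bounded_linear (star :: 'a::cstar_algebra \<Rightarrow> 'a)"
  by (rule bounded_linear_intro[where K = 1]) (simp_all add: star_add star_scaleR norm_star)

lemmas star_simps = star_add star_scaleR star_mult star_star linear_diff[OF linear_star]
  linear_0[OF linear_star] linear_neg[OF linear_star] linear_sum[OF linear_star]

text \<open>The left regular representation is isometric and places the algebra, unital or not,
  inside an operator algebra with unit.\<close>

definition Lmul :: "'a::cstar_algebra \<Rightarrow> 'a bop" where
  "Lmul a = bop_of ((*) a)"

lemma Lmul_apply [simp]: "Lmul a \<rhd> b = a * b"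
  unfolding Lmul_def by (rule bapply_bop_of[OF bounded_linear_mult_right])

lemma Lmul_add: "Lmul (a + b) = Lmul a + Lmul b"
  by (rule bop_eqI) (simp add: bapply_simps distrib_right)

lemma Lmul_scaleR: "Lmul (r *\<^sub>R a) = r *\<^sub>R Lmul a"
  by (rule bop_eqI) (simp add: bapply_simps)

lemma Lmul_mult: "Lmul (a * b) = Lmul a * Lmul b"
  by (rule bop_eqI) (simp add: bapply_simps mult.assoc)

lemma norm_Lmul: "norm (Lmul a) = norm a"
proof (rule antisym)
  show "norm (Lmul a) \<le> norm a"
    by (rule norm_bop_bound) (simp_all add: norm_mult_ineq)
  have "norm a * norm a \<le> norm (Lmul a) * norm a"
    using norm_bapply[of "Lmul a" "star a"] cstar_identity[of "star a"]
    by (simp add: star_star norm_star power2_eq_square)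
  then show "norm a \<le> norm (Lmul a)" by (cases "a = 0") simp_all
qed

lemma adjp_Lmul: "alg.adjp (Lmul a) (Lmul (star a))"
  by (simp add: alg.adjp_def star_mult mult.assoc)

text \<open>Sums are immediate here, unlike for \<open>cstar_pos\<close>. Only the passage from
  \<open>cstar_pos\<close> to \<open>cpos\<close> is established, so \<open>cpos\<close> serves norm
  estimates, while new frame bounds have to be shown with \<open>cstar_pos\<close>.\<close>

definition cpos :: "'a::cstar_algebra \<Rightarrow> bool" where
  "cpos a \<longleftrightarrow> alg.posop (Lmul a)"

lemma cpos_star_mult: "cpos (star b * b)"
  unfolding cpos_def Lmul_mult by (rule alg.posop_adjoint_times[OF adjp_Lmul])

lemma cpos_of_cstar_pos: "cstar_pos a \<Longrightarrow> cpos a"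
  by (auto simp: cstar_pos_def cpos_star_mult)

lemma cpos_add: "cpos a \<Longrightarrow> cpos b \<Longrightarrow> cpos (a + b)"
  by (simp add: cpos_def Lmul_add alg.posop_add)

lemma cpos_scaleR: "cpos a \<Longrightarrow> 0 \<le> r \<Longrightarrow> cpos (r *\<^sub>R a)"
  by (simp add: cpos_def Lmul_scaleR alg.posop_scaleR)

lemma norm_cpos_mono: "cpos a \<Longrightarrow> cpos b \<Longrightarrow> norm a \<le> norm (a + b)"
  using alg.norm_posop_mono[of "Lmul a" "Lmul b"]
  by (simp add: cpos_def norm_Lmul flip: Lmul_add)

lemma cpos_zero: "cpos 0"
  using cpos_star_mult[of 0] by simp

lemma cpos_sum: "(\<And>i. i \<in> I \<Longrightarrow> cpos (f i)) \<Longrightarrow> cpos (sum f I)"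
  by (induction I rule: infinite_finite_induct) (simp_all add: cpos_zero cpos_add)

lemma cstar_pos_scaleR:
  assumes "cstar_pos a" "0 \<le> r"
  shows "cstar_pos (r *\<^sub>R a)"
proof -
  obtain b where "a = star b * b" using assms(1) by (auto simp: cstar_pos_def)
  then have "r *\<^sub>R a = star (sqrt r *\<^sub>R b) * (sqrt r *\<^sub>R b)"
    using assms(2) by (simp add: star_scaleR)
  then show ?thesis unfolding cstar_pos_def by blast
qed

text \<open>The root of 1 - p/s is an operator on the algebra, but its value d at c is an element,
  and \<open>star d * d\<close> equals \<open>star c\<close> (1 - p/s) c even without a
  unit.\<close>

lemma cpos_conj_diff:
  assumes p: "star p = p" and s: "norm p \<le> s" "0 < s"
  shows "cpos (s *\<^sub>R (star c * c) - star c * p * c)"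
proof -
  define K where "K = (1/s) *\<^sub>R Lmul p"
  have K: "norm K \<le> 1" using s by (simp add: K_def norm_Lmul)
  have saK: "alg.sa K"
    unfolding K_def using adjp_Lmul[of p] by (intro alg.adjp_scaleR) (simp add: p)
  obtain Y where Y: "alg.sa Y" "norm Y \<le> 1 - sqrt (1 - 1)" "(1 - Y) * (1 - Y) = 1 - K"
    "\<And>Z. Z * K = K * Z \<Longrightarrow> Z * Y = Y * Z"
    by (rule alg.sa_sqrt[OF saK K order_refl]) (rule that)
  define d where "d = (1 - Y) \<rhd> c"
  have "star d * d = star c * (((1 - Y) * (1 - Y)) \<rhd> c)"
    unfolding d_def bapply_times
    by (rule alg.adjpD) (intro alg.adjp_intros Y)
  also have "\<dots> = star c * (c - (1/s) *\<^sub>R (p * c))"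
    by (simp add: Y(3) K_def bapply_simps)
  finally have "s *\<^sub>R (star d * d) = s *\<^sub>R (star c * c) - star c * p * c"
    using s by (simp add: right_diff_distrib scaleR_diff_right mult.assoc)
  then show ?thesis using cpos_scaleR[OF cpos_star_mult[of d]] s by (metis less_imp_le)
qed

text \<open>
  The left-hand side of the hypothesis is the square $\langle z,z\rangle$ of
  $z = x\,c/s - y$ for $p=\langle x,x\rangle$, $c=\langle x,y\rangle$, $q=\langle y,y\rangle$.
\<close>

lemma cauchy_schwarz_core:
  assumes p: "star p = p"
    and pos: "\<And>s. norm p < s \<Longrightarrow>
      cpos ((1 / s\<^sup>2) *\<^sub>R (star c * p * c) - (2 / s) *\<^sub>R (star c * c) + q)"
  shows "(norm c)\<^sup>2 \<le> norm p * norm q"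
proof -
  have le: "(norm c)\<^sup>2 \<le> s * norm q" if s: "norm p < s" for s
  proof -
    have s0: "0 < s" using s norm_ge_zero le_less_trans by blast
    \<comment> \<open>Adding v trades the term in p for one in \<open>star c * c\<close>. What
      remains is q minus \<open>star c * c\<close> divided by s, to which monotonicity of the norm
      applies.\<close>
    define v where "v = (1 / s\<^sup>2) *\<^sub>R (s *\<^sub>R (star c * c) - star c * p * c)"
    define w where "w = (1 / s\<^sup>2) *\<^sub>R (star c * p * c) - (2 / s) *\<^sub>R (star c * c) + q"
    have "cpos v" unfolding v_def
      using s s0 p by (intro cpos_scaleR cpos_conj_diff) simp_all
    moreover have "cpos w" unfolding w_def by (rule pos[OF s])
    ultimately have "cpos (v + w)" by (rule cpos_add)
    moreover have "v = (1/s) *\<^sub>R (star c * c) - (1 / s\<^sup>2) *\<^sub>R (star c * p * c)"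
      using s0 by (simp add: v_def scaleR_diff_right power2_eq_square)
    then have "(1/s) *\<^sub>R (star c * c) + (v + w) =
        (1/s) *\<^sub>R (star c * c) + (1/s) *\<^sub>R (star c * c) - (2/s) *\<^sub>R (star c * c) + q"
      by (simp add: w_def)
    then have "(1/s) *\<^sub>R (star c * c) + (v + w) = q"
      by (simp flip: scaleR_left_distrib)
    moreover have "cpos ((1/s) *\<^sub>R (star c * c))"
      using s0 by (intro cpos_scaleR cpos_star_mult) simp
    ultimately have "norm ((1/s) *\<^sub>R (star c * c)) \<le> norm q"
      using norm_cpos_mono by metis
    then show ?thesis using s0 by (simp add: cstar_identity field_simps)
  qed
  show ?thesis
  \<comment> \<open>The strict inequality norm p < s keeps s positive also when p = 0; now s
    decreases to norm p.\<close>
  proof (rule tendsto_lowerbound)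
    show "((\<lambda>s. s * norm q) \<longlongrightarrow> norm p * norm q) (at_right (norm p))"
      by (intro tendsto_intros)
    show "\<forall>\<^sub>F s in at_right (norm p). (norm c)\<^sup>2 \<le> s * norm q"
      using eventually_at_right_less by (rule eventually_mono) (rule le)
  qed simp
qed

context hilbert_module
begin

theorem hilbert_cs: "hilbert_cs act ip"
proof (intro hilbert_cs.intro hilbert_cs_axioms.intro hilbert_module_axioms)
  fix x y
  define c where "c = ip x y"
  have c: "ip x y = c" "ip y x = star c" by (simp_all add: c_def ip_star)
  have "(norm c)\<^sup>2 \<le> norm (ip x x) * norm (ip y y)"
  proof (rule cauchy_schwarz_core)
    show "star (ip x x) = ip x x" by (rule ip_star)
    fix s :: real assume "norm (ip x x) < s"
    define z where "z = (1/s) *\<^sub>R act x c - y"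
    have "ip z z = (1 / s\<^sup>2) *\<^sub>R (star c * ip x x * c) - (1/s) *\<^sub>R (star c * c) -
        (1/s) *\<^sub>R (star c * c) + ip y y"
      by (simp add: z_def ip_simps ip_act_left ip_act_right c mult.assoc power2_eq_square
          algebra_simps)
    then have "ip z z = (1 / s\<^sup>2) *\<^sub>R (star c * ip x x * c) - (2/s) *\<^sub>R (star c * c) + ip y y"
      by (simp add: diff_diff_eq flip: scaleR_left_distrib)
    then show "cpos ((1 / s\<^sup>2) *\<^sub>R (star c * ip x x * c) - (2/s) *\<^sub>R (star c * c) + ip y y)"
      using cpos_of_cstar_pos[OF ip_pos[of z]] by simp
  qed
  then have "(norm c)\<^sup>2 \<le> (norm x * norm y)\<^sup>2"
    by (simp add: norm_ip_self power_mult_distrib)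
  then show "norm (ip x y) \<le> norm x * norm y"
    unfolding c_def by (rule power2_le_imp_le) simp
qed

end

section \<open>Square-summable sequences\<close>

text \<open>This is Cauchy-Schwarz in A^n with tuples as bare functions.
  \<open>cauchy_schwarz_core\<close> mentions only p, c and q, so it applies without making A^n a
  module.\<close>

lemma norm_sum_star_mult_le:
  fixes u v :: "'i \<Rightarrow> 'a::cstar_algebra"
  shows "(norm (\<Sum>i\<in>I. star (u i) * v i))\<^sup>2 \<le>
    norm (\<Sum>i\<in>I. star (u i) * u i) * norm (\<Sum>i\<in>I. star (v i) * v i)"
proof (rule cauchy_schwarz_core)
  show "star (\<Sum>i\<in>I. star (u i) * u i) = (\<Sum>i\<in>I. star (u i) * u i)"
    by (simp add: star_simps)
  fix s :: real assume "norm (\<Sum>i\<in>I. star (u i) * u i) < s"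
  define c where "c = (\<Sum>i\<in>I. star (u i) * v i)"
  define z where "z i = (1/s) *\<^sub>R (u i * c) - v i" for i
  have star_c: "star c = (\<Sum>i\<in>I. star (v i) * u i)"
    by (simp add: c_def star_simps)
  have "(\<Sum>i\<in>I. star (z i) * z i) = (\<Sum>i\<in>I. (1 / s\<^sup>2) *\<^sub>R (star c * (star (u i) * u i) * c)
      - (1/s) *\<^sub>R (star c * (star (u i) * v i)) - (1/s) *\<^sub>R (star (v i) * u i * c)
      + star (v i) * v i)"
    by (rule sum.cong) (simp_all add: z_def star_simps power2_eq_square algebra_simps)
  also have "\<dots> = (1 / s\<^sup>2) *\<^sub>R (star c * (\<Sum>i\<in>I. star (u i) * u i) * c)
      - (1/s) *\<^sub>R (star c * c) - (1/s) *\<^sub>R (star c * c) + (\<Sum>i\<in>I. star (v i) * v i)"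
    unfolding star_c[symmetric] c_def[symmetric]
    by (simp add: sum.distrib sum_subtractf c_def[symmetric] star_c[symmetric]
        flip: scaleR_sum_right sum_distrib_left sum_distrib_right)
  also have "\<dots> = (1 / s\<^sup>2) *\<^sub>R (star c * (\<Sum>i\<in>I. star (u i) * u i) * c)
      - (2/s) *\<^sub>R (star c * c) + (\<Sum>i\<in>I. star (v i) * v i)"
    by (simp add: diff_diff_eq flip: scaleR_left_distrib)
  finally have eq: "(\<Sum>i\<in>I. star (z i) * z i) = \<dots>" .
  have "cpos (\<Sum>i\<in>I. star (z i) * z i)"
    by (intro cpos_sum cpos_star_mult)
  then show "cpos ((1 / s\<^sup>2) *\<^sub>R (star (\<Sum>i\<in>I. star (u i) * v i) * (\<Sum>i\<in>I. star (u i) * u i) *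
      (\<Sum>i\<in>I. star (u i) * v i)) - (2/s) *\<^sub>R (star (\<Sum>i\<in>I. star (u i) * v i) *
      (\<Sum>i\<in>I. star (u i) * v i)) + (\<Sum>i\<in>I. star (v i) * v i))"
    by (simp only: eq c_def)
qed

definition l2 :: "(nat \<Rightarrow> 'a::cstar_algebra) set" where
  "l2 = {a. summable (\<lambda>n. star (a n) * a n)}"

abbreviation l2_ip :: "(nat \<Rightarrow> 'a::cstar_algebra) \<Rightarrow> (nat \<Rightarrow> 'a) \<Rightarrow> 'a" where
  "l2_ip a b \<equiv> (\<Sum>n. star (a n) * b n)"

definition l2_norm :: "(nat \<Rightarrow> 'a::cstar_algebra) \<Rightarrow> real" where
  "l2_norm a = sqrt (norm (l2_ip a a))"

lemma l2_norm_ge0: "0 \<le> l2_norm a"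
  by (simp add: l2_norm_def)

lemma norm_l2_ip_self: "norm (l2_ip a a) = (l2_norm a)\<^sup>2"
  by (simp add: l2_norm_def)

lemma norm_sum_le_l2_norm:
  assumes a: "a \<in> l2" and "finite F"
  shows "norm (\<Sum>n\<in>F. star (a n) * a n) \<le> (l2_norm a)\<^sup>2"
proof -
  obtain N where N: "F \<subseteq> {..<N}" using assms(2) finite_nat_iff_bounded by blast
  have "(\<lambda>n. norm (\<Sum>i<n. star (a i) * a i)) \<longlonglongrightarrow> norm (l2_ip a a)"
    using a by (intro tendsto_norm summable_LIMSEQ) (simp add: l2_def)
  then show ?thesis unfolding norm_l2_ip_self
  proof (rule tendsto_lowerbound)
    have "norm (\<Sum>n\<in>F. star (a n) * a n) \<le> norm (\<Sum>i<n. star (a i) * a i)" if "N \<le> n" for n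
    proof -
      have "F \<subseteq> {..<n}" using N that by auto
      then have "(\<Sum>i<n. star (a i) * a i) =
          (\<Sum>i\<in>F. star (a i) * a i) + (\<Sum>i\<in>{..<n} - F. star (a i) * a i)"
        by (simp add: sum.subset_diff add.commute)
      then show ?thesis
        by (simp add: norm_cpos_mono cpos_sum cpos_star_mult)
    qed
    then show "\<forall>\<^sub>F n in sequentially.
        norm (\<Sum>n\<in>F. star (a n) * a n) \<le> norm (\<Sum>i<n. star (a i) * a i)"
      by (auto simp: eventually_sequentially)
  qed simp
qed

lemma norm_sum_l2_ip_le:
  assumes "a \<in> l2" "finite F"
  shows "norm (\<Sum>n\<in>F. star (a n) * b n) \<le> l2_norm a * sqrt (norm (\<Sum>n\<in>F. star (b n) * b n))"
proof (rule power2_le_imp_le)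
  have "(norm (\<Sum>n\<in>F. star (a n) * b n))\<^sup>2 \<le>
      norm (\<Sum>n\<in>F. star (a n) * a n) * norm (\<Sum>n\<in>F. star (b n) * b n)"
    by (rule norm_sum_star_mult_le)
  also have "\<dots> \<le> (l2_norm a)\<^sup>2 * norm (\<Sum>n\<in>F. star (b n) * b n)"
    by (intro mult_right_mono norm_sum_le_l2_norm assms) simp
  finally show "(norm (\<Sum>n\<in>F. star (a n) * b n))\<^sup>2 \<le>
      (l2_norm a * sqrt (norm (\<Sum>n\<in>F. star (b n) * b n)))\<^sup>2"
    by (simp add: power_mult_distrib)
qed (simp add: l2_norm_ge0)

text \<open>Convergence need not be absolute, so blocks are estimated as a whole against blocks of
  \<open>b\<close>. Both the inner product of l2 and the synthesis series of a frame converge for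
  this reason.\<close>

lemma summable_of_l2_bound:
  fixes f :: "nat \<Rightarrow> 'b::banach" and b :: "nat \<Rightarrow> 'a::cstar_algebra"
  assumes b: "b \<in> l2" and M: "0 \<le> M"
    and le: "\<And>m n. norm (sum f {m..<n}) \<le> M * sqrt (norm (\<Sum>i=m..<n. star (b i) * b i))"
  shows "summable f"
  unfolding summable_Cauchy
proof (intro allI impI)
  fix e :: real assume e: "0 < e"
  define d where "d = e / (M + 1)"
  have d: "0 < d" using e M by (simp add: d_def)
  then have "0 < d\<^sup>2" by simp
  then obtain N where N: "\<And>m n. m \<ge> N \<Longrightarrow> norm (\<Sum>i=m..<n. star (b i) * b i) < d\<^sup>2"
    using b unfolding l2_def mem_Collect_eq summable_Cauchy by meson
  have "norm (sum f {m..<n}) < e" if "m \<ge> N" for m n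
  proof -
    have "sqrt (norm (\<Sum>i=m..<n. star (b i) * b i)) \<le> d"
      using N[OF that, of n] d by (simp add: real_le_lsqrt less_imp_le)
    then have "norm (sum f {m..<n}) \<le> M * d"
      using le[of m n] M mult_left_mono order_trans by blast
    also have "\<dots> < (M + 1) * d" using d by simp
    also have "\<dots> = e" using M by (simp add: d_def)
    finally show ?thesis .
  qed
  then show "\<exists>N. \<forall>m\<ge>N. \<forall>n. norm (sum f {m..<n}) < e" by blast
qed

lemma summable_l2_ip: "a \<in> l2 \<Longrightarrow> b \<in> l2 \<Longrightarrow> summable (\<lambda>n. star (a n) * b n)"
  by (rule summable_of_l2_bound[OF _ l2_norm_ge0 norm_sum_l2_ip_le]) simp_all

lemma l2_add:
  assumes "a \<in> l2" "b \<in> l2"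
  shows "(\<lambda>n. a n + b n) \<in> l2"
    and "l2_ip (\<lambda>n. a n + b n) (\<lambda>n. a n + b n) =
      l2_ip a a + l2_ip a b + (l2_ip b a + l2_ip b b)"
proof -
  have eq: "star (a n + b n) * (a n + b n) =
      star (a n) * a n + star (a n) * b n + (star (b n) * a n + star (b n) * b n)" for n
    by (simp add: star_add algebra_simps)
  note sums = summable_l2_ip[OF assms(1,1)] summable_l2_ip[OF assms]
    summable_l2_ip[OF assms(2,1)] summable_l2_ip[OF assms(2,2)]
  show "(\<lambda>n. a n + b n) \<in> l2"
    unfolding l2_def mem_Collect_eq eq by (intro summable_add sums)
  show "l2_ip (\<lambda>n. a n + b n) (\<lambda>n. a n + b n) =
      l2_ip a a + l2_ip a b + (l2_ip b a + l2_ip b b)"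
    unfolding eq by (simp add: suminf_add[symmetric] summable_add sums)
qed

lemma norm_l2_ip_le:
  assumes "a \<in> l2" "b \<in> l2"
  shows "norm (l2_ip a b) \<le> l2_norm a * l2_norm b"
proof (rule tendsto_upperbound)
  show "(\<lambda>n. norm (\<Sum>i<n. star (a i) * b i)) \<longlonglongrightarrow> norm (l2_ip a b)"
    by (intro tendsto_norm summable_LIMSEQ summable_l2_ip assms)
  have "norm (\<Sum>i<n. star (a i) * b i) \<le> l2_norm a * l2_norm b" for n
  proof -
    have "sqrt (norm (\<Sum>i<n. star (b i) * b i)) \<le> l2_norm b"
      using norm_sum_le_l2_norm[OF assms(2), of "{..<n}"] by (simp add: real_le_lsqrt l2_norm_ge0)
    then show ?thesis
      using norm_sum_l2_ip_le[OF assms(1), of "{..<n}" b] mult_left_mono[OF _ l2_norm_ge0, of _ _ a]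
      by fastforce
  qed
  then show "\<forall>\<^sub>F n in sequentially. norm (\<Sum>i<n. star (a i) * b i) \<le> l2_norm a * l2_norm b"
    by simp
qed simp

lemma l2_norm_triangle:
  assumes "a \<in> l2" "b \<in> l2"
  shows "l2_norm (\<lambda>n. a n + b n) \<le> l2_norm a + l2_norm b"
proof (rule power2_le_imp_le)
  have "(l2_norm (\<lambda>n. a n + b n))\<^sup>2 = norm (l2_ip a a + l2_ip a b + (l2_ip b a + l2_ip b b))"
    by (simp add: l2_add(2)[OF assms] flip: norm_l2_ip_self)
  also have "\<dots> \<le> norm (l2_ip a a) + norm (l2_ip a b) + (norm (l2_ip b a) + norm (l2_ip b b))"
    by (intro norm_triangle_le add_mono order_refl)
  also have "\<dots> \<le> (l2_norm a)\<^sup>2 + l2_norm a * l2_norm b + (l2_norm b * l2_norm a + (l2_norm b)\<^sup>2)"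
    unfolding norm_l2_ip_self by (intro add_mono norm_l2_ip_le assms order_refl)
  also have "\<dots> = (l2_norm a + l2_norm b)\<^sup>2"
    by (simp add: power2_eq_square algebra_simps)
  finally show "(l2_norm (\<lambda>n. a n + b n))\<^sup>2 \<le> (l2_norm a + l2_norm b)\<^sup>2" .
qed (simp add: l2_norm_ge0)

lemma l2_minus:
  assumes "a \<in> l2"
  shows "(\<lambda>n. - a n) \<in> l2" "l2_norm (\<lambda>n. - a n) = l2_norm a"
  using assms by (simp_all add: l2_def l2_norm_def star_simps)

lemma l2_diff:
  assumes "a \<in> l2" "b \<in> l2"
  shows "(\<lambda>n. a n - b n) \<in> l2"
    and "l2_norm (\<lambda>n. a n - b n) \<le> l2_norm a + l2_norm b"
    and "l2_norm a \<le> l2_norm b + l2_norm (\<lambda>n. a n - b n)"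
    and "l2_norm b \<le> l2_norm a + l2_norm (\<lambda>n. a n - b n)"
proof -
  note m = l2_minus[OF assms(2)]
  show d: "(\<lambda>n. a n - b n) \<in> l2" using l2_add(1)[OF assms(1) m(1)] by simp
  show "l2_norm (\<lambda>n. a n - b n) \<le> l2_norm a + l2_norm b"
    using l2_norm_triangle[OF assms(1) m(1)] m(2) by simp
  show "l2_norm a \<le> l2_norm b + l2_norm (\<lambda>n. a n - b n)"
    using l2_norm_triangle[OF assms(2) d] by simp
  show "l2_norm b \<le> l2_norm a + l2_norm (\<lambda>n. a n - b n)"
    using l2_norm_triangle[OF assms(1) l2_minus(1)[OF d]] l2_minus(2)[OF d] by simp
qed

section \<open>Roots of operators bounded below\<close>

context hilbert_cs
begin

text \<open>The estimate behind it is K^2 \<le> l K for l > k, from l K (l - K) = (l - K) K (l - K)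
  + K (l - K) K. It is carried out on A-valued inner products with y = K z and u = (l - K)
  z.\<close>

lemma norm_le_of_cpos:
  assumes K: "sa K" and pos: "\<And>z. cpos (ip z (K \<rhd> z))"
    and le: "\<And>z. cpos (k *\<^sub>R ip z z - ip z (K \<rhd> z))" and k: "0 \<le> k"
  shows "norm K \<le> k"
proof (rule dense_ge)
  fix l assume "k < l"
  then have l: "0 < l" using k by simp
  have le: "cpos (l *\<^sub>R ip z z - ip z (K \<rhd> z))" for z
  proof -
    have "cpos ((k *\<^sub>R ip z z - ip z (K \<rhd> z)) + (l - k) *\<^sub>R ip z z)"
      using \<open>k < l\<close> by (intro cpos_add cpos_scaleR le cpos_of_cstar_pos ip_pos) simp
    then show ?thesis by (simp add: algebra_simps)
  qed
  show "norm K \<le> l"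
  proof (rule norm_bop_bound)
    fix z
    define y where "y = K \<rhd> z"
    define u where "u = l *\<^sub>R z - y"
    have "cpos (ip u (K \<rhd> u) + (l *\<^sub>R ip y y - ip y (K \<rhd> y)))"
      by (intro cpos_add pos le)
    moreover have "l *\<^sub>R l *\<^sub>R ip z y =
        l *\<^sub>R ip y y + (ip u (K \<rhd> u) + (l *\<^sub>R ip y y - ip y (K \<rhd> y)))"
      using adjpD[OF K, of z y] adjpD[OF K, of z z]
      by (simp add: u_def y_def[symmetric] bapply_simps ip_simps algebra_simps)
    moreover have "cpos (l *\<^sub>R ip y y)"
      using l by (intro cpos_scaleR cpos_of_cstar_pos ip_pos) simp
    ultimately have "norm (l *\<^sub>R ip y y) \<le> norm (l *\<^sub>R l *\<^sub>R ip z y)"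
      using norm_cpos_mono by metis
    then have "(norm y)\<^sup>2 \<le> l * norm (ip z y)"
      using l by (simp add: norm_ip_self)
    also have "norm (ip z y) \<le> norm (l *\<^sub>R ip z z)"
      using norm_cpos_mono[OF pos[of z] le[of z]] by (simp add: y_def)
    also have "l * norm (l *\<^sub>R ip z z) = (l * norm z)\<^sup>2"
      using l by (simp add: norm_ip_self power2_eq_square)
    finally have "(norm y)\<^sup>2 \<le> (l * norm z)\<^sup>2" using l by simp
    then show "norm (K \<rhd> z) \<le> l * norm z"
      unfolding y_def by (rule power2_le_imp_le) (use l in simp)
  qed (use l in simp)
qed

text \<open>Writing the defect as \<open>ip (g \<rhd> z) (g \<rhd> z)\<close> gives positivity in
  the sense of \<open>cstar_pos\<close>, which is what the frame inequalities demand.\<close>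

lemma contraction_compl_square:
  assumes "norm K \<le> 1" "sa K"
  shows "\<exists>g. \<forall>z. ip z z - ip z (K \<rhd> z) = ip (g \<rhd> z) (g \<rhd> z)"
proof -
  obtain Y where Y: "sa Y" "norm Y \<le> 1 - sqrt (1 - 1)" "(1 - Y) * (1 - Y) = 1 - K"
    "\<And>Z. Z * K = K * Z \<Longrightarrow> Z * Y = Y * Z"
    by (rule sa_sqrt[OF assms(2,1) order_refl]) (rule that)
  have saY: "sa (1 - Y)" by (intro adjp_intros Y)
  have "ip z z - ip z (K \<rhd> z) = ip ((1 - Y) \<rhd> z) ((1 - Y) \<rhd> z)" for z
  proof -
    have "ip ((1 - Y) \<rhd> z) ((1 - Y) \<rhd> z) = ip z ((1 - K) \<rhd> z)"
      by (simp only: adjpD[OF saY] Y(3)[symmetric] bapply_times)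
    then show ?thesis by (simp add: bapply_simps ip_simps)
  qed
  then show ?thesis by blast
qed

text \<open>The inverse P of G squares to the inverse square root of T and thereby witnesses
  \<open>op_pos\<close> for it. The last conclusion asks for closure under squares, not products,
  since a product of self-adjoint operators need not be self-adjoint.\<close>

lemma fourth_root:
  assumes T: "sa T" and AB: "0 < A" "A \<le> B" and K: "norm (1 - (1/B) *\<^sub>R T) \<le> 1 - A / B"
  obtains P G where "sa P" "sa G" "P * G = 1" "G * P = 1" "G * G * (G * G) = T"
    "norm (sqrt B *\<^sub>R 1 - G * G) \<le> sqrt B - sqrt A"
    "\<And>C. closed C \<Longrightarrow> 0 \<in> C \<Longrightarrow> 1 \<in> C \<Longrightarrow> T \<in> C \<Longrightarrow>
      (\<And>S S'. S \<in> C \<Longrightarrow> S' \<in> C \<Longrightarrow> S + S' \<in> C) \<Longrightarrow> (\<And>r S. S \<in> C \<Longrightarrow> r *\<^sub>R S \<in> C) \<Longrightarrow>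
      (\<And>S. S \<in> C \<Longrightarrow> S * S \<in> C) \<Longrightarrow> G \<in> C"
proof -
  define K where "K = 1 - (1/B) *\<^sub>R T"
  have B: "0 < B" using AB by simp
  have K1: "norm K \<le> 1 - A / B" using K by (simp add: K_def)
  have K2: "1 - A / B \<le> 1" using AB B by simp
  have saK: "sa K" unfolding K_def by (intro adjp_intros T)
  obtain Y where Y: "sa Y" "norm Y \<le> 1 - sqrt (1 - (1 - A / B))" "(1 - Y) * (1 - Y) = 1 - K"
    "\<And>C. closed C \<Longrightarrow> 0 \<in> C \<Longrightarrow> (\<And>Z. Z \<in> C \<Longrightarrow> (1/2) *\<^sub>R (K + Z * Z) \<in> C) \<Longrightarrow> Y \<in> C"
  proof (rule sa_sqrt_closed[OF saK K1 K2], goal_cases)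
    case (1 Y) from 1(2-) show ?case by (rule 1(1))
  qed
  \<comment> \<open>Here T = B (1 - K), and the bound for Y simplifies to 1 - sqrt (A/B). Since A >
    0 it is below 1, so norm X < 1 and the second root 1 - X is invertible.\<close>
  define l where "l = 1 - sqrt (A / B)"
  have l: "norm Y \<le> l" "l \<le> 1" "l < 1" using Y(2) AB B by (simp_all add: l_def)
  obtain X where X: "sa X" "norm X \<le> 1 - sqrt (1 - l)" "(1 - X) * (1 - X) = 1 - Y"
    "\<And>C. closed C \<Longrightarrow> 0 \<in> C \<Longrightarrow> (\<And>Z. Z \<in> C \<Longrightarrow> (1/2) *\<^sub>R (Y + Z * Z) \<in> C) \<Longrightarrow> X \<in> C"
  proof (rule sa_sqrt_closed[OF Y(1) l(1,2)], goal_cases)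
    case (1 X) from 1(2-) show ?case by (rule 1(1))
  qed
  have "0 < sqrt (1 - l)" using l by simp
  then have "norm X < 1" using X(2) by linarith
  then obtain Z where Z: "(1 - X) * Z = 1" "Z * (1 - X) = 1"
    by (rule banach_algebra_inverse)
  define b where "b = sqrt (sqrt B)"
  have b: "0 < b" "b * b = sqrt B" using B by (simp_all add: b_def)
  define G P where "G = b *\<^sub>R (1 - X)" and "P = (1/b) *\<^sub>R Z"
  have G: "sa G" unfolding G_def by (intro adjp_intros X)
  have PG: "P * G = 1" "G * P = 1" using Z b by (simp_all add: G_def P_def)
  have "sa P" unfolding adjp_def
  proof (intro allI)
    fix x y
    have GP: "G \<rhd> P \<rhd> z = z" for z using PG(2) by (simp flip: bapply_times)
    show "ip (P \<rhd> x) y = ip x (P \<rhd> y)"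
      using adjpD[OF G, of "P \<rhd> x" "P \<rhd> y"] by (simp add: GP)
  qed
  moreover have GG: "G * G = sqrt B *\<^sub>R (1 - Y)"
    using b by (simp add: G_def X(3))
  then have "G * G * (G * G) = B *\<^sub>R ((1 - Y) * (1 - Y))"
    using B by simp
  then have "G * G * (G * G) = T"
    using B by (simp add: Y(3) K_def)
  moreover have "norm (sqrt B *\<^sub>R 1 - G * G) \<le> sqrt B - sqrt A"
  proof -
    have "norm (sqrt B *\<^sub>R 1 - G * G) = sqrt B * norm Y"
      using B by (simp add: GG scaleR_diff_right)
    also have "\<dots> \<le> sqrt B * l" using B l by simp
    also have "\<dots> = sqrt B - sqrt A"
      using B by (simp add: l_def real_sqrt_divide right_diff_distrib)
    finally show ?thesis .
  qed
  moreover have "G \<in> C" if "closed C" "0 \<in> C" "1 \<in> C" "T \<in> C"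
    and add: "\<And>S S'. S \<in> C \<Longrightarrow> S' \<in> C \<Longrightarrow> S + S' \<in> C"
    and scale: "\<And>r S. S \<in> C \<Longrightarrow> r *\<^sub>R S \<in> C"
    and square: "\<And>S. S \<in> C \<Longrightarrow> S * S \<in> C" for C
  proof -
    have diff: "S - S' \<in> C" if "S \<in> C" "S' \<in> C" for S S'
      using add[OF that(1) scale[OF that(2), of "- 1"]] by simp
    have "K \<in> C" unfolding K_def by (intro diff scale that)
    then have "Y \<in> C" by (intro Y(4) that add scale square)
    then have "X \<in> C" by (intro X(4) that add scale square)
    then show "G \<in> C" unfolding G_def by (intro diff scale that)
  qed
  ultimately show ?thesis using G PG by (intro that[of P G]) blast+
qed

end

section \<open>Uniqueness of inverse square roots\<close>

text \<open>
  This treats \<open>X\<close> and \<open>M(X)\<close> alike: the maps \<open>e i\<close> are the identity in the first case and the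
  evaluations \<open>v \<mapsto> v a\<close> in the second, and inner products are determined by those of the values.
\<close>

locale represented_module = hilbert_cs act ip
  for act :: "'x::complex_banach \<Rightarrow> 'a::cstar_algebra \<Rightarrow> 'x" and ip +
  fixes M :: "('b, 'm) ip_module" and e :: "'i \<Rightarrow> 'm \<Rightarrow> 'x" and lift :: "'x bop \<Rightarrow> 'm \<Rightarrow> 'm"
  assumes e_inj: "v \<in> mcarrier M \<Longrightarrow> w \<in> mcarrier M \<Longrightarrow> (\<And>i. e i v = e i w) \<Longrightarrow> v = w"
    and mip_eq_iff: "v \<in> mcarrier M \<Longrightarrow> w \<in> mcarrier M \<Longrightarrow> v' \<in> mcarrier M \<Longrightarrow> w' \<in> mcarrier M \<Longrightarrow>
      mip M v w = mip M v' w' \<longleftrightarrow> (\<forall>i j. ip (e i v) (e j w) = ip (e i v') (e j w'))"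
    and lift_in: "adjp C D \<Longrightarrow> v \<in> mcarrier M \<Longrightarrow> lift C v \<in> mcarrier M"
    and e_lift: "adjp C D \<Longrightarrow> v \<in> mcarrier M \<Longrightarrow> e i (lift C v) = C \<rhd> e i v"
begin

definition L :: "'x bop \<Rightarrow> 'm \<Rightarrow> 'm" where
  "L C = (\<lambda>v\<in>mcarrier M. lift C v)"

lemma L_in: "adjp C D \<Longrightarrow> v \<in> mcarrier M \<Longrightarrow> L C v \<in> mcarrier M"
  by (simp add: L_def lift_in)

lemma e_L: "adjp C D \<Longrightarrow> v \<in> mcarrier M \<Longrightarrow> e i (L C v) = C \<rhd> e i v"
  by (simp add: L_def e_lift)

lemma L_funcset: "adjp C D \<Longrightarrow> L C \<in> mcarrier M \<rightarrow>\<^sub>E mcarrier M"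
  by (auto simp: L_in) (simp add: L_def)

lemma L_times:
  assumes "adjp C D" "adjp C' D'" "v \<in> mcarrier M"
  shows "L C (L C' v) = L (C * C') v"
proof (rule e_inj)
  have CC: "adjp (C * C') (D' * D)" by (rule adjp_times[OF assms(1,2)])
  show "L C (L C' v) \<in> mcarrier M" "L (C * C') v \<in> mcarrier M"
    using assms CC by (auto intro!: L_in)
  show "e i (L C (L C' v)) = e i (L (C * C') v)" for i
    using assms CC L_in[OF assms(2,3)]
    by (simp add: e_L[of _ "D' * D"] e_L[of _ D] e_L[of _ D'] bapply_times)
qed

lemma L_one: "v \<in> mcarrier M \<Longrightarrow> L 1 v = v"
  by (rule e_inj) (auto simp: e_L[OF adjp_one] intro: L_in[OF adjp_one])

lemma adj_pair_iff:
  assumes "S \<in> mcarrier M \<rightarrow> mcarrier M" "S' \<in> mcarrier M \<rightarrow> mcarrier M"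
  shows "adj_pair M M S S' \<longleftrightarrow> (\<forall>v\<in>mcarrier M. \<forall>w\<in>mcarrier M. \<forall>i j.
    ip (e i (S v)) (e j w) = ip (e i v) (e j (S' w)))"
proof -
  have "mip M (S v) w = mip M v (S' w) \<longleftrightarrow>
      (\<forall>i j. ip (e i (S v)) (e j w) = ip (e i v) (e j (S' w)))"
    if "v \<in> mcarrier M" "w \<in> mcarrier M" for v w
    using that assms by (intro mip_eq_iff) auto
  then show ?thesis by (simp add: adj_pair_def)
qed

lemma eqI_ip:
  assumes "s \<in> mcarrier M" "t \<in> mcarrier M"
    and eq: "\<And>v i j. v \<in> mcarrier M \<Longrightarrow> ip (e i v) (e j s) = ip (e i v) (e j t)"
  shows "s = t"
proof (rule e_inj[OF assms(1,2)])
  fix i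
  have "ip (e i s - e i t) (e i s - e i t) = 0"
    using eq[OF assms(1), of i i] eq[OF assms(2), of i i] by (simp add: ip_simps)
  then have "norm (e i s - e i t) = 0" by (simp add: norm_eq_ip)
  then show "e i s = e i t" by simp
qed

lemma adj_eqI:
  assumes S: "S \<in> mcarrier M \<rightarrow>\<^sub>E mcarrier M" and S': "S' \<in> mcarrier M \<rightarrow>\<^sub>E mcarrier M"
    and pair: "adj_pair M M S S'"
  shows "adj M M S = S'"
  unfolding adj_def
proof (rule the_equality)
  fix S'' assume S'': "S'' \<in> mcarrier M \<rightarrow>\<^sub>E mcarrier M \<and> adj_pair M M S S''"
  show "S'' = S'"
  proof (rule PiE_ext[where k = "mcarrier M" and s = "\<lambda>_. mcarrier M"])
    fix w assume w: "w \<in> mcarrier M"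
    show "S'' w = S' w"
    proof (rule eqI_ip)
      fix v i j assume v: "v \<in> mcarrier M"
      have fn: "S \<in> mcarrier M \<rightarrow> mcarrier M" "S' \<in> mcarrier M \<rightarrow> mcarrier M"
        "S'' \<in> mcarrier M \<rightarrow> mcarrier M" using S S' S'' by auto
      have "ip (e i (S v)) (e j w) = ip (e i v) (e j (S'' w))"
        using S'' v w unfolding adj_pair_iff[OF fn(1,3)] by blast
      moreover have "ip (e i (S v)) (e j w) = ip (e i v) (e j (S' w))"
        using pair v w unfolding adj_pair_iff[OF fn(1,2)] by blast
      ultimately show "ip (e i v) (e j (S'' w)) = ip (e i v) (e j (S' w))" by simp
    qed (use w S' S'' in auto)
  qed (use S' S'' in auto)
qed (use S' pair in simp)

lemma L_adj_pair: "adjp C D \<Longrightarrow> adj_pair M M (L C) (L D)"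
  by (subst adj_pair_iff) (auto simp: L_in adjp_sym[THEN L_in] e_L adjp_sym[THEN e_L] adjpD)

lemma L_adjointable: "adjp C D \<Longrightarrow> L C \<in> adjointables M M"
  unfolding adjointables_def using L_funcset adjp_sym L_adj_pair by blast

lemma adj_L: "adjp C D \<Longrightarrow> adj M M (L C) = L D"
  by (intro adj_eqI L_adj_pair L_funcset) (auto dest: adjp_sym)

lemma compose_L:
  assumes "adjp C D" "adjp C' D'"
  shows "compose (mcarrier M) (L C) (L C') = L (C * C')"
proof (rule PiE_ext[where k = "mcarrier M" and s = "\<lambda>_. mcarrier M"])
  show "compose (mcarrier M) (L C) (L C') \<in> mcarrier M \<rightarrow>\<^sub>E mcarrier M"
    using assms by (auto simp: compose_def intro!: L_in)
  show "L (C * C') \<in> mcarrier M \<rightarrow>\<^sub>E mcarrier M"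
    by (rule L_funcset[OF adjp_times[OF assms]])
qed (use assms in \<open>simp add: compose_eq L_times\<close>)

lemma op_id_eq: "op_id M = L 1"
proof (rule PiE_ext[where k = "mcarrier M" and s = "\<lambda>_. mcarrier M"])
  show "L 1 \<in> mcarrier M \<rightarrow>\<^sub>E mcarrier M" by (rule L_funcset[OF adjp_one])
qed (auto simp: op_id_def L_one)

lemma op_inv_L:
  assumes "adjp T T'" "adjp Q Q'" and TQ: "T * Q = 1" "Q * T = 1"
  shows "op_inv M (L T) = L Q"
  unfolding op_inv_def
proof (rule the_equality)
  show "L Q \<in> adjointables M M \<and> compose (mcarrier M) (L Q) (L T) = op_id M \<and>
      compose (mcarrier M) (L T) (L Q) = op_id M"
    using assms by (simp add: L_adjointable[OF assms(2)] compose_L[OF assms(1,2)]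
        compose_L[OF assms(2,1)] op_id_eq)
  fix S assume S: "S \<in> adjointables M M \<and> compose (mcarrier M) S (L T) = op_id M \<and>
      compose (mcarrier M) (L T) S = op_id M"
  show "S = L Q"
  proof (rule PiE_ext[where k = "mcarrier M" and s = "\<lambda>_. mcarrier M"])
    show "S \<in> mcarrier M \<rightarrow>\<^sub>E mcarrier M" using S by (auto simp: adjointables_def)
    show "L Q \<in> mcarrier M \<rightarrow>\<^sub>E mcarrier M" by (rule L_funcset[OF assms(2)])
    fix v assume v: "v \<in> mcarrier M"
    have Qv: "L Q v \<in> mcarrier M" by (rule L_in[OF assms(2) v])
    have "S (L T (L Q v)) = L Q v"
      using S Qv by (metis compose_eq op_id_eq L_one)
    then show "S v = L Q v"
      using v assms by (simp add: L_times[OF assms(1,2) v] L_one)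
  qed
qed

definition commuting :: "('m \<Rightarrow> 'm) \<Rightarrow> 'x bop set" where
  "commuting S = {Z. sa Z \<and> (\<forall>v\<in>mcarrier M. S (L Z v) = L Z (S v))}"

text \<open>M carries no topology, so commutation is rewritten as equations between inner products
  in X. Moving \<open>S\<close> to the left factor by its symmetry leaves \<open>Z\<close> acting on
  fixed vectors, and both sides become continuous in \<open>Z\<close>.\<close>

lemma closed_commuting:
  assumes S: "S \<in> mcarrier M \<rightarrow> mcarrier M" and self_adj: "adj_pair M M S S"
  shows "closed (commuting S)"
    and "Z \<in> commuting S \<Longrightarrow> Z' \<in> commuting S \<Longrightarrow> Z + Z' \<in> commuting S"
    and "Z \<in> commuting S \<Longrightarrow> r *\<^sub>R Z \<in> commuting S"
proof -
  interpret ip: bounded_bilinear ip by (rule bounded_bilinear_ip)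
  have S_in: "S v \<in> mcarrier M" if "v \<in> mcarrier M" for v using S that by auto
  have Sip: "ip (e i (S v)) (e j w) = ip (e i v) (e j (S w))"
    if "v \<in> mcarrier M" "w \<in> mcarrier M" for v w i j
    using self_adj that unfolding adj_pair_iff[OF S S] by blast
  define D where "D = {Z. \<forall>v w i j. v \<in> mcarrier M \<longrightarrow> w \<in> mcarrier M \<longrightarrow>
    ip (e i (S w)) (Z \<rhd> e j v) = ip (e i w) (Z \<rhd> e j (S v))}"
  have iff: "(\<forall>v\<in>mcarrier M. S (L Z v) = L Z (S v)) \<longleftrightarrow> Z \<in> D" if Z: "sa Z" for Z
  proof
    assume comm: "\<forall>v\<in>mcarrier M. S (L Z v) = L Z (S v)"
    have "ip (e i (S w)) (Z \<rhd> e j v) = ip (e i w) (Z \<rhd> e j (S v))"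
      if "v \<in> mcarrier M" "w \<in> mcarrier M" for v w i j
      using Sip[OF that(2) L_in[OF Z that(1)], of i j] comm that
      by (simp add: e_L[OF Z] S_in)
    then show "Z \<in> D" by (simp add: D_def)
  next
    assume "Z \<in> D"
    show "\<forall>v\<in>mcarrier M. S (L Z v) = L Z (S v)"
    proof (intro ballI eqI_ip)
      fix v w i j assume v: "v \<in> mcarrier M" and w: "w \<in> mcarrier M"
      have "ip (e i w) (e j (S (L Z v))) = ip (e i (S w)) (Z \<rhd> e j v)"
        using Sip[OF w L_in[OF Z v], of i j] by (simp add: e_L[OF Z v])
      also have "\<dots> = ip (e i w) (e j (L Z (S v)))"
        using \<open>Z \<in> D\<close> v w by (simp add: D_def e_L[OF Z] S_in)
      finally show "ip (e i w) (e j (S (L Z v))) = ip (e i w) (e j (L Z (S v)))" .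
    qed (auto intro: S_in L_in[OF Z])
  qed
  have C: "commuting S = {Z. sa Z} \<inter> D" unfolding commuting_def using iff by blast
  have "closed D"
    unfolding D_def
    by (intro closed_Collect_all closed_Collect_imp closed_Collect_eq open_Collect_const
        ip.continuous_on bapply.continuous_on continuous_intros)
  then show "closed (commuting S)" unfolding C using closed_sa by (rule closed_Int[rotated])
  show "Z + Z' \<in> commuting S" if "Z \<in> commuting S" "Z' \<in> commuting S"
    using that unfolding C by (simp add: D_def adjp_add bapply_simps ip_simps)
  show "r *\<^sub>R Z \<in> commuting S" if "Z \<in> commuting S"
    using that unfolding C by (simp add: D_def adjp_scaleR bapply_simps ip_simps)
qed

text \<open>
  A positive root \<open>S\<close> of \<open>L (R * R)\<close>, with \<open>R = P * P\<close>, commutes with \<open>L R\<close>, as \<open>R\<close> is a limit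
  of polynomials in \<open>T\<close>. Hence \<open>d = (S - R) v\<close> satisfies \<open>S d = - R d\<close>, so that
  $\langle d,Sd\rangle+\langle d,Rd\rangle=0$ with both summands positive.
\<close>

lemma op_inv_sqrt_L:
  assumes P: "sa P" and G: "sa G" and PG: "P * G = 1" "G * P = 1" and T: "G * G * (G * G) = T"
    and approx: "\<And>C. closed C \<Longrightarrow> 0 \<in> C \<Longrightarrow> 1 \<in> C \<Longrightarrow> T \<in> C \<Longrightarrow>
      (\<And>S S'. S \<in> C \<Longrightarrow> S' \<in> C \<Longrightarrow> S + S' \<in> C) \<Longrightarrow> (\<And>r S. S \<in> C \<Longrightarrow> r *\<^sub>R S \<in> C) \<Longrightarrow>
      (\<And>S. S \<in> C \<Longrightarrow> S * S \<in> C) \<Longrightarrow> G \<in> C"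
  shows "op_inv_sqrt M (L T) = L (P * P)"
proof -
  define R Q where "R = P * P" and "Q = R * R"
  have R: "sa R" and Q: "sa Q" unfolding R_def Q_def by (intro adjp_intros P)+
  have saT: "sa T" unfolding T[symmetric] by (intro adjp_intros G)
  have TQ: "T * Q = 1" "Q * T = 1"
    unfolding T[symmetric] Q_def R_def
    by (metis PG mult.assoc mult_1_left mult_1_right)+
  have inv: "op_inv M (L T) = L Q" by (rule op_inv_L[OF saT Q TQ])
  have "op_sqrt M (L Q) = L R"
    unfolding op_sqrt_def
  proof (rule the_equality)
    have "op_pos M (L R)"
      unfolding op_pos_def
      using L_adjointable[OF P]
      by (intro bexI[of _ "L P"]) (simp_all add: adj_L[OF P] compose_L[OF P P] R_def)
    then show "L R \<in> adjointables M M \<and> op_pos M (L R) \<and> compose (mcarrier M) (L R) (L R) = L Q"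
      by (simp add: L_adjointable[OF R] compose_L[OF R R] Q_def)
    fix S
    assume S: "S \<in> adjointables M M \<and> op_pos M S \<and> compose (mcarrier M) S S = L Q"
    then have S_PiE: "S \<in> mcarrier M \<rightarrow>\<^sub>E mcarrier M" by (auto simp: adjointables_def)
    then have S_fun: "S \<in> mcarrier M \<rightarrow> mcarrier M" by auto
    have S_in: "S v \<in> mcarrier M" if "v \<in> mcarrier M" for v using S_fun that by auto
    have SS: "S (S v) = L Q v" if "v \<in> mcarrier M" for v
      using S that by (metis compose_eq)
    obtain N where N: "N \<in> adjointables M M" "S = compose (mcarrier M) (adj M M N) N"
      using S unfolding op_pos_def by blast
    then obtain N' where N': "N' \<in> mcarrier M \<rightarrow>\<^sub>E mcarrier M" "adj_pair M M N N'"
      and N_PiE: "N \<in> mcarrier M \<rightarrow>\<^sub>E mcarrier M"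
      by (auto simp: adjointables_def)
    have adjN: "adj M M N = N'" by (rule adj_eqI[OF N_PiE N'])
    have N_fun: "N \<in> mcarrier M \<rightarrow> mcarrier M" "N' \<in> mcarrier M \<rightarrow> mcarrier M"
      using N_PiE N'(1) by auto
    have N_in: "N v \<in> mcarrier M" if "v \<in> mcarrier M" for v using N_fun that by auto
    have pos: "ip (e i v) (e j (S w)) = ip (e i (N v)) (e j (N w))"
      if "v \<in> mcarrier M" "w \<in> mcarrier M" for v w i j
      using N'(2) that N_in[OF that(2)] unfolding adj_pair_iff[OF N_fun]
      by (simp add: N(2) adjN compose_eq)
    then have "ip (e i (S v)) (e j w) = ip (e i (N v)) (e j (N w))"
      if "v \<in> mcarrier M" "w \<in> mcarrier M" for v w i j
      using that by (metis ip_star)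
    with pos have self_adj: "adj_pair M M S S"
      unfolding adj_pair_iff[OF S_fun S_fun] by simp
    have comm_inv: "S (L Z' v) = L Z' (S v)"
      if Z: "sa Z" "sa Z'" "Z * Z' = 1" "Z' * Z = 1" and v: "v \<in> mcarrier M"
        and comm: "\<And>v. v \<in> mcarrier M \<Longrightarrow> S (L Z v) = L Z (S v)" for Z Z' v
    proof -
      have Zv: "L Z' v \<in> mcarrier M" by (rule L_in[OF Z(2) v])
      have "L Z' (S v) = L Z' (S (L Z (L Z' v)))"
        using v by (simp add: L_times[OF Z(1,2)] Z L_one)
      also have "\<dots> = L Z' (L Z (S (L Z' v)))"
        by (simp add: comm[OF Zv])
      also have "\<dots> = S (L Z' v)"
        using S_in[OF Zv] by (simp add: L_times[OF Z(2,1)] Z L_one)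
      finally show ?thesis by simp
    qed
    \<comment> \<open>\<open>L Q\<close> is the square of S, hence commutes with it; T is the
      inverse of Q, and commutation passes to inverses.\<close>
    have "S (L Q v) = L Q (S v)" if "v \<in> mcarrier M" for v
      using SS[OF that] SS[OF S_in[OF that]] by simp
    then have "T \<in> commuting S"
      using comm_inv[OF Q saT TQ(2,1)] saT by (simp add: commuting_def)
    have "G \<in> commuting S"
    proof (rule approx)
      note C = closed_commuting[OF S_fun self_adj]
      show "closed (commuting S)" by (rule C(1))
      show one: "1 \<in> commuting S" using S_in by (simp add: commuting_def adjp_one L_one)
      show "0 \<in> commuting S" using C(3)[OF one, of 0] by simp
      show "T \<in> commuting S" by fact
      show "Z + Z' \<in> commuting S" if "Z \<in> commuting S" "Z' \<in> commuting S" for Z Z'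
        by (rule C(2)[OF that])
      show "r *\<^sub>R Z \<in> commuting S" if "Z \<in> commuting S" for r Z by (rule C(3)[OF that])
      show "Z * Z \<in> commuting S" if "Z \<in> commuting S" for Z
      proof -
        have Z: "sa Z" and comm: "\<And>v. v \<in> mcarrier M \<Longrightarrow> S (L Z v) = L Z (S v)"
          using that by (auto simp: commuting_def)
        have "S (L (Z * Z) v) = L (Z * Z) (S v)" if "v \<in> mcarrier M" for v
          using comm[OF that] comm[OF L_in[OF Z that]]
          by (simp add: S_in that flip: L_times[OF Z Z])
        then show ?thesis using adjp_times[OF Z Z] by (simp add: commuting_def)
      qed
    qed
    then have commG: "S (L G v) = L G (S v)" if "v \<in> mcarrier M" for v
      using that by (simp add: commuting_def)
    have commP: "S (L P v) = L P (S v)" if "v \<in> mcarrier M" for v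
      by (rule comm_inv[OF G P PG(2,1) that commG])
    have commR: "S (L R v) = L R (S v)" if "v \<in> mcarrier M" for v
      using commP[OF that] commP[OF L_in[OF P that]]
      by (simp add: R_def S_in that flip: L_times[OF P P])
    show "S = L R"
    proof (rule PiE_ext[OF S_PiE L_funcset[OF R]])
      fix v assume v: "v \<in> mcarrier M"
      note Sv = S_in[OF v] and Rv = L_in[OF R v]
      show "S v = L R v"
      proof (rule e_inj[OF Sv Rv])
        fix i
        \<comment> \<open>M has no addition here, so the differences of S v and R v, and of their
          images under N, are formed in X after evaluation.\<close>
        define d where "d = e i (S v) - e i (L R v)"
        define n where "n = e i (N (S v)) - e i (N (L R v))"
        have "e i (S (S v)) - e i (S (L R v)) = R \<rhd> R \<rhd> e i v - R \<rhd> e i (S v)"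
          using Sv v by (simp add: SS commR e_L[OF Q] e_L[OF R]) (simp add: Q_def bapply_times)
        also have "\<dots> = - (R \<rhd> d)"
          using v by (simp add: d_def bapply_simps e_L[OF R])
        finally have Sd: "e i (S (S v)) - e i (S (L R v)) = - (R \<rhd> d)" .
        have "ip n n = ip d (e i (S (S v)) - e i (S (L R v)))"
          unfolding n_def d_def
          by (simp add: ip_simps pos[OF Sv Sv] pos[OF Sv Rv] pos[OF Rv Sv] pos[OF Rv Rv])
        also have "\<dots> = - ip (P \<rhd> d) (P \<rhd> d)"
          unfolding Sd by (simp add: ip_simps adjpD[OF P] R_def bapply_times)
        finally have "ip (P \<rhd> d) (P \<rhd> d) + ip n n = 0" by simp
        then have "norm (ip (P \<rhd> d) (P \<rhd> d)) \<le> 0"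
          using norm_cpos_mono[OF cpos_of_cstar_pos[OF ip_pos[of "P \<rhd> d"]]
              cpos_of_cstar_pos[OF ip_pos[of n]]] by simp
        then have "P \<rhd> d = 0" by (simp add: norm_ip_self)
        then have "(G * P) \<rhd> d = 0" by (simp add: bapply_simps)
        then show "e i (S v) = e i (L R v)" by (simp add: PG d_def)
      qed
    qed
  qed
  then show ?thesis by (simp add: op_inv_sqrt_def inv R_def)
qed

end

section \<open>Frames and outer frames\<close>

lemma mcarrier_type_mod [simp]: "mcarrier (type_mod ip) = UNIV"
  and mip_type_mod [simp]: "mip (type_mod ip) = ip"
  by (simp_all add: type_mod_def)

lemma mcarrier_l2_mod [simp]: "mcarrier l2_mod = l2"
  and mip_l2_mod [simp]: "mip l2_mod = l2_ip"
  by (simp_all add: l2_mod_def l2_def)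

lemma mcarrier_alg_mod [simp]: "mcarrier alg_mod = UNIV"
  and mip_alg_mod [simp]: "mip alg_mod = (\<lambda>a b. star a * b)"
  by (simp_all add: alg_mod_def)

lemma adj_l2_eqI:
  assumes S: "\<And>a c. c \<in> l2 \<Longrightarrow> l2_ip (v a) c = star a * S c"
  shows "adj alg_mod l2_mod v = restrict S l2"
  unfolding adj_def
proof (rule the_equality)
  show "restrict S l2 \<in> mcarrier l2_mod \<rightarrow>\<^sub>E mcarrier alg_mod \<and>
      adj_pair alg_mod l2_mod v (restrict S l2)"
    by (auto simp: adj_pair_def S)
  fix S' assume S': "S' \<in> mcarrier l2_mod \<rightarrow>\<^sub>E mcarrier alg_mod \<and> adj_pair alg_mod l2_mod v S'"
  show "S' = restrict S l2"
  proof
    fix c show "S' c = restrict S l2 c"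
    proof (cases "c \<in> l2")
      case True
      have "S' c = S c"
        by (rule alg_mod_eqI) (use S' S True in \<open>simp add: adj_pair_def\<close>)
      then show ?thesis using True by simp
    qed (use S' in \<open>auto simp: PiE_def extensional_def\<close>)
  qed
qed

abbreviation mult_carrier :: "('x \<Rightarrow> 'x \<Rightarrow> 'a::cstar_algebra) \<Rightarrow> ('a \<Rightarrow> 'x) set" where
  "mult_carrier ip \<equiv> mcarrier (mult_mod (type_mod ip))"

lemma mult_carrierI: "(\<And>a y. ip (v a) y = star a * S y) \<Longrightarrow> v \<in> mult_carrier ip"
  by (auto simp: mult_mod_def adjointables_def adj_pair_def intro!: bexI[of _ S])

lemma mip_mult_mod: "mip (mult_mod (type_mod ip)) v w = pairing ip v \<circ> w"
  by (simp add: mult_mod_def pairing_def fun_eq_iff)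

context hilbert_module
begin

text \<open>Frames and outer frames differ only in whether every \<open>x n\<close> comes from X.
  Admitting both leaves one condition on sequences in M(X).\<close>

lemma gen_frame_bounds_iff:
  "gen_frame_bounds act ip x A B \<longleftrightarrow> A > 0 \<and> B > 0 \<and> (\<forall>n. x n \<in> mult_carrier ip) \<and>
     (\<forall>z. summable (\<lambda>n. star (pairing ip (x n) z) * pairing ip (x n) z) \<and>
          A *\<^sub>R ip z z \<preceq> (\<Sum>n. star (pairing ip (x n) z) * pairing ip (x n) z) \<and>
          (\<Sum>n. star (pairing ip (x n) z) * pairing ip (x n) z) \<preceq> B *\<^sub>R ip z z)"
  (is "_ \<longleftrightarrow> ?R")
proof -
  have frame: "frame_bounds ip x' A B \<longleftrightarrow> ?R" if "x = (\<lambda>n. mult_embed act (x' n))" for x'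
    unfolding that frame_bounds_def
    by (simp add: pairing_mult_embed ip_star mult_embed_in_mult_mod)
  show ?thesis
  proof (cases "\<exists>n. x n \<notin> range (mult_embed act)")
    case True
    then have "\<nexists>x'. x = (\<lambda>n. mult_embed act (x' n)) \<and> frame_bounds ip x' A B" by auto
    then have "gen_frame_bounds act ip x A B \<longleftrightarrow> outer_frame_bounds act ip x A B"
      unfolding gen_frame_bounds_def by argo
    with True show ?thesis
      by (simp add: outer_frame_bounds_def)
  next
    case False
    then have "\<forall>n. \<exists>y. x n = mult_embed act y" by blast
    then obtain x' where "\<forall>n. x n = mult_embed act (x' n)" by metis
    then have x': "x = (\<lambda>n. mult_embed act (x' n))" by blast
    have "\<not> outer_frame_bounds act ip x A B"
      using False by (simp add: outer_frame_bounds_def)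
    then have "gen_frame_bounds act ip x A B \<longleftrightarrow>
        (\<exists>x'. x = (\<lambda>n. mult_embed act (x' n)) \<and> frame_bounds ip x' A B)"
      by (simp add: gen_frame_bounds_def)
    also have "\<dots> \<longleftrightarrow> ?R"
    proof
      assume "\<exists>x'. x = (\<lambda>n. mult_embed act (x' n)) \<and> frame_bounds ip x' A B"
      then obtain x' where "x = (\<lambda>n. mult_embed act (x' n))" "frame_bounds ip x' A B" by blast
      then show ?R using frame[of x'] by simp
    next
      assume ?R
      then have "frame_bounds ip x' A B" using frame[OF x'] by simp
      with x' show "\<exists>x'. x = (\<lambda>n. mult_embed act (x' n)) \<and> frame_bounds ip x' A B" by blast
    qed
    finally show ?thesis .
  qed
qed

lemma linear_pairing:
  assumes v: "v \<in> mult_carrier ip"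
  shows "linear (pairing ip v)"
proof (rule linearI)
  fix x y and r :: real
  show "pairing ip v (x + y) = pairing ip v x + pairing ip v y"
    by (rule alg_mod_eqI) (simp add: distrib_left ip_add_right flip: pairing_eq[OF v])
  show "pairing ip v (r *\<^sub>R x) = r *\<^sub>R pairing ip v x"
    by (rule alg_mod_eqI) (simp add: ip_scaleR_right flip: pairing_eq[OF v])
qed

lemma linear_of_symmetric:
  assumes "\<And>x y. ip (f x) y = ip x (f y)"
  shows "linear f"
proof (rule linearI)
  show "f (x + y) = f x + f y" for x y
    by (rule ip_eqI) (simp add: ip_add_right flip: assms)
  show "f (r *\<^sub>R x) = r *\<^sub>R f x" for r x
    by (rule ip_eqI) (simp add: ip_scaleR_right flip: assms)
qed

end

section \<open>Analysis, synthesis and frame operators\<close>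

locale module_frame = hilbert_cs act ip
  for act :: "'x::complex_banach \<Rightarrow> 'a::cstar_algebra \<Rightarrow> 'x" and ip +
  fixes x :: "nat \<Rightarrow> 'a \<Rightarrow> 'x" and A B :: real
  assumes gen_frame_bounds: "gen_frame_bounds act ip x A B"
begin

abbreviation U :: "'x \<Rightarrow> nat \<Rightarrow> 'a" where
  "U \<equiv> analysis_op ip x"

lemma A_pos: "0 < A" and B_pos: "0 < B" and x_in: "x n \<in> mult_carrier ip"
  and U_in: "U z \<in> l2"
  and lower: "cstar_pos (l2_ip (U z) (U z) - A *\<^sub>R ip z z)"
  and upper: "cstar_pos (B *\<^sub>R ip z z - l2_ip (U z) (U z))"
  using gen_frame_bounds unfolding gen_frame_bounds_iff
  by (auto simp: l2_def analysis_op_def cstar_le_def)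

lemma U_linear: "linear (\<lambda>z. U z n)"
  unfolding analysis_op_def by (rule linear_pairing[OF x_in])

lemma ip_x: "ip (x n a) z = star a * U z n"
  unfolding analysis_op_def by (rule pairing_eq[OF x_in])

lemma ip_x': "ip z (x n a) = star (U z n) * a"
  by (metis ip_x ip_star star_mult star_star)

text \<open>By the lower frame bound the series is \<open>A *\<^sub>R ip z z\<close> plus a positive
  element, so no limit of positive elements has to be taken.\<close>

lemma cpos_l2_ip_U: "cpos (l2_ip (U z) (U z))"
  using cpos_add[OF cpos_of_cstar_pos[OF lower[of z]]
      cpos_scaleR[OF cpos_of_cstar_pos[OF ip_pos[of z]] less_imp_le[OF A_pos]]] by simp

lemma U_norm_le: "(l2_norm (U z))\<^sup>2 \<le> B * (norm z)\<^sup>2"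
proof -
  have "norm (l2_ip (U z) (U z)) \<le> norm (B *\<^sub>R ip z z)"
    using norm_cpos_mono[OF cpos_l2_ip_U[of z] cpos_of_cstar_pos[OF upper[of z]]] by simp
  then show ?thesis using B_pos by (simp add: norm_ip_self norm_l2_ip_self)
qed

lemma U_norm_ge: "A * (norm z)\<^sup>2 \<le> (l2_norm (U z))\<^sup>2"
proof -
  have "norm (A *\<^sub>R ip z z) \<le> norm (l2_ip (U z) (U z))"
    using norm_cpos_mono[OF cpos_scaleR[OF cpos_of_cstar_pos[OF ip_pos[of z]] less_imp_le[OF A_pos]]
        cpos_of_cstar_pos[OF lower[of z]]] by simp
  then show ?thesis using A_pos by (simp add: norm_ip_self norm_l2_ip_self)
qed

lemma U_bound: "l2_norm (U z) \<le> sqrt B * norm z"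
  using real_sqrt_le_mono[OF U_norm_le[of z]] by (simp add: real_sqrt_mult l2_norm_ge0)

text \<open>The synthesis operator, which on l2 is the adjoint of \<open>U\<close>. As
  \<open>x n\<close> is a map from the algebra to X, \<open>x n (a n)\<close> is the product of x_n
  and a_n.\<close>

definition V :: "(nat \<Rightarrow> 'a) \<Rightarrow> 'x" where
  "V a = (\<Sum>n. x n (a n))"

text \<open>A block y of the series is tested against itself: \<open>ip y y\<close> pairs
  \<open>U y\<close> with a block of \<open>a\<close>, and the bound for \<open>U y\<close> lets one
  factor norm y be cancelled.\<close>

lemma V_summable:
  assumes a: "a \<in> l2"
  shows "summable (\<lambda>n. x n (a n))"
proof (rule summable_of_l2_bound[OF a])
  fix m n
  define y where "y = (\<Sum>i=m..<n. x i (a i))"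
  let ?s = "sqrt (norm (\<Sum>i=m..<n. star (a i) * a i))"
  have "ip y y = (\<Sum>i=m..<n. star (U y i) * a i)"
    unfolding y_def by (subst linear_sum[OF linear_ip_right]) (simp add: ip_x')
  then have "(norm y)\<^sup>2 \<le> l2_norm (U y) * ?s"
    using norm_sum_l2_ip_le[OF U_in[of y], of "{m..<n}" a] by (simp flip: norm_ip_self)
  also have "\<dots> \<le> (sqrt B * norm y) * ?s"
    by (intro mult_right_mono U_bound) simp
  finally have "norm y * norm y \<le> (sqrt B * ?s) * norm y"
    by (simp add: power2_eq_square mult_ac)
  then show "norm y \<le> sqrt B * ?s"
    using B_pos by (cases "y = 0") simp_all
qed (use B_pos in simp)

lemma ip_V:
  assumes a: "a \<in> l2"
  shows "ip z (V a) = l2_ip (U z) a"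
proof -
  interpret ip: bounded_bilinear ip by (rule bounded_bilinear_ip)
  show ?thesis
    unfolding V_def
    by (simp add: bounded_linear.suminf[OF ip.bounded_linear_right V_summable[OF a]] ip_x')
qed

lemma ip_V':
  assumes a: "a \<in> l2"
  shows "ip (V a) z = l2_ip a (U z)"
proof -
  have "ip (V a) z = star (l2_ip (U z) a)"
    by (simp add: ip_star flip: ip_V[OF a])
  also have "\<dots> = l2_ip a (U z)"
    by (simp add: bounded_linear.suminf[OF bounded_linear_star summable_l2_ip[OF U_in a]]
        star_mult star_star)
  finally show ?thesis .
qed

definition T :: "'x bop" where
  "T = bop_of (\<lambda>z. V (U z))"

lemma T_apply: "T \<rhd> z = V (U z)"
proof -
  have "norm (V (U z)) \<le> B * norm z" for z
  proof -
    define y where "y = V (U z)"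
    have "(norm y)\<^sup>2 = norm (l2_ip (U y) (U z))"
      by (simp add: y_def U_in flip: norm_ip_self ip_V)
    also have "\<dots> \<le> l2_norm (U y) * l2_norm (U z)"
      by (intro norm_l2_ip_le U_in)
    also have "\<dots> \<le> (sqrt B * norm y) * (sqrt B * norm z)"
      by (intro mult_mono U_bound) (use B_pos in \<open>simp_all add: l2_norm_ge0\<close>)
    also have "\<dots> = B * norm z * norm y"
      using B_pos by (simp add: algebra_simps)
    finally have "norm y * norm y \<le> B * norm z * norm y" by (simp add: power2_eq_square)
    then show ?thesis using B_pos unfolding y_def[symmetric] by (cases "y = 0") simp_all
  qed
  moreover have "linear (\<lambda>z. V (U z))"
    by (rule linear_of_symmetric) (simp add: ip_V ip_V' U_in)
  ultimately have "bounded_linear (\<lambda>z. V (U z))"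
    by (intro bounded_linear.intro bounded_linear_axioms.intro) (auto simp: mult.commute)
  then show ?thesis unfolding T_def by (rule bapply_bop_of)
qed

lemma sa_T: "sa T"
  by (simp add: adjp_def T_apply ip_V ip_V' U_in)

lemma ip_T: "ip z (T \<rhd> w) = l2_ip (U z) (U w)"
  by (simp add: T_apply ip_V U_in)

lemma adj_U: "adj (type_mod ip) l2_mod U = restrict V l2"
  unfolding adj_def
proof (rule the_equality)
  show "restrict V l2 \<in> mcarrier l2_mod \<rightarrow>\<^sub>E mcarrier (type_mod ip) \<and>
      adj_pair (type_mod ip) l2_mod U (restrict V l2)"
    by (auto simp: adj_pair_def ip_V)
  fix S assume S: "S \<in> mcarrier l2_mod \<rightarrow>\<^sub>E mcarrier (type_mod ip) \<and>
      adj_pair (type_mod ip) l2_mod U S"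
  show "S = restrict V l2"
  proof
    fix a show "S a = restrict V l2 a"
    proof (cases "a \<in> l2")
      case True
      have "S a = V a"
        by (rule ip_eqI) (use S True in \<open>simp add: adj_pair_def ip_V\<close>)
      then show ?thesis using True by simp
    qed (use S in \<open>auto simp: PiE_def extensional_def\<close>)
  qed
qed

lemma frame_op_eq: "compose (mcarrier (type_mod ip)) (adj (type_mod ip) l2_mod U) U = (\<rhd>) T"
  by (rule ext) (simp add: adj_U compose_def U_in T_apply)

lemma V_in_mult:
  assumes "a \<in> mcarrier (mult_mod l2_mod)"
  shows "V \<circ> a \<in> mult_carrier ip" and "a b \<in> l2"
proof -
  have in_adj: "a \<in> adjointables alg_mod l2_mod" using assms by (simp add: mult_mod_def)
  then have a: "a b \<in> l2" for b by (auto simp: adjointables_def)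
  obtain S where "adj_pair alg_mod l2_mod a S"
    using in_adj unfolding adjointables_def by blast
  then have S: "l2_ip (a b) c = star b * S c" if "c \<in> l2" for b c
    using that by (simp add: adj_pair_def)
  show "a b \<in> l2" by (rule a)
  show "V \<circ> a \<in> mult_carrier ip"
    by (rule mult_carrierI[where S = "\<lambda>z. S (U z)"]) (simp add: ip_V' a S U_in)
qed

lemma l2_ip_U_mult:
  assumes "v \<in> mult_carrier ip" "c \<in> l2"
  shows "l2_ip (U (v a)) c = star a * pairing ip v (V c)"
  using assms by (simp add: pairing_eq flip: ip_V)

lemma U_in_mult:
  assumes v: "v \<in> mult_carrier ip"
  shows "U \<circ> v \<in> mcarrier (mult_mod l2_mod)"
proof -
  have "adj_pair alg_mod l2_mod (U \<circ> v) (restrict (\<lambda>c. pairing ip v (V c)) l2)"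
    by (simp add: adj_pair_def l2_ip_U_mult[OF v])
  then show ?thesis
    unfolding mult_mod_def adjointables_def by (auto simp: U_in)
qed

lemma adj_U_mult:
  "adj (mult_mod (type_mod ip)) (mult_mod l2_mod) (op_ext (type_mod ip) U) =
    (\<lambda>a\<in>mcarrier (mult_mod l2_mod). V \<circ> a)"
  unfolding adj_def
proof (rule the_equality)
  have mip_eq: "mip (mult_mod l2_mod) (op_ext (type_mod ip) U v) a = pairing ip v \<circ> (V \<circ> a)"
    if "v \<in> mult_carrier ip" "a \<in> mcarrier (mult_mod l2_mod)" for v a
  proof -
    have "adj alg_mod l2_mod (U \<circ> v) = restrict (\<lambda>c. pairing ip v (V c)) l2"
      by (rule adj_l2_eqI) (simp add: l2_ip_U_mult[OF that(1)])
    then show ?thesis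
      using that by (simp add: mult_mod_def op_ext_def fun_eq_iff V_in_mult(2))
  qed
  show "(\<lambda>a\<in>mcarrier (mult_mod l2_mod). V \<circ> a) \<in>
        mcarrier (mult_mod l2_mod) \<rightarrow>\<^sub>E mult_carrier ip \<and>
      adj_pair (mult_mod (type_mod ip)) (mult_mod l2_mod) (op_ext (type_mod ip) U)
        (\<lambda>a\<in>mcarrier (mult_mod l2_mod). V \<circ> a)"
    by (auto simp: adj_pair_def mip_eq mip_mult_mod V_in_mult)
  fix S
  assume S: "S \<in> mcarrier (mult_mod l2_mod) \<rightarrow>\<^sub>E mult_carrier ip \<and>
      adj_pair (mult_mod (type_mod ip)) (mult_mod l2_mod) (op_ext (type_mod ip) U) S"
  show "S = (\<lambda>a\<in>mcarrier (mult_mod l2_mod). V \<circ> a)"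
  proof
    fix a show "S a = (\<lambda>a\<in>mcarrier (mult_mod l2_mod). V \<circ> a) a"
    proof (cases "a \<in> mcarrier (mult_mod l2_mod)")
      case True
      have "S a = V \<circ> a"
      proof
        fix b show "S a b = (V \<circ> a) b"
        proof (rule ip_eqI)
          fix z
          \<comment> \<open>Multipliers coming from vectors z of X already separate the values, so
            testing against them is enough.\<close>
          have "pairing ip (mult_embed act z) \<circ> (V \<circ> a) = pairing ip (mult_embed act z) \<circ> S a"
            using S True mult_embed_in_mult_mod[of z]
            by (simp add: adj_pair_def mip_eq mip_mult_mod)
          then have "pairing ip (mult_embed act z) (V (a b)) =
              pairing ip (mult_embed act z) (S a b)"
            by (metis comp_apply)
          then show "ip z (S a b) = ip z ((V \<circ> a) b)"
            by (simp add: pairing_mult_embed)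
        qed
      qed
      then show ?thesis using True by simp
    qed (use S in \<open>auto simp: PiE_def extensional_def\<close>)
  qed
qed

text \<open>The multiplier frame operator is T acting on values. Hence one root of T on X serves
  M(X) as well.\<close>

lemma mult_frame_op_eq:
  "compose (mult_carrier ip)
      (adj (mult_mod (type_mod ip)) (mult_mod l2_mod) (op_ext (type_mod ip) U))
      (op_ext (type_mod ip) U) = (\<lambda>v\<in>mult_carrier ip. \<lambda>a. T \<rhd> v a)"
proof
  have ext: "op_ext (type_mod ip) U v = U \<circ> v" if "v \<in> mult_carrier ip" for v
    using that by (simp add: op_ext_def)
  show "compose (mult_carrier ip)
      (adj (mult_mod (type_mod ip)) (mult_mod l2_mod) (op_ext (type_mod ip) U))
      (op_ext (type_mod ip) U) v = (\<lambda>v\<in>mult_carrier ip. \<lambda>a. T \<rhd> v a) v" for v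
    unfolding adj_U_mult by (simp add: compose_def ext U_in_mult T_apply fun_eq_iff)
qed

end

context hilbert_cs
begin

lemma represented_type_mod:
  "represented_module act ip (type_mod ip) (\<lambda>(_::unit) v. v) (\<lambda>C v. C \<rhd> v)"
  by unfold_locales simp_all

lemma represented_mult_mod:
  "represented_module act ip (mult_mod (type_mod ip)) (\<lambda>a v. v a) (\<lambda>C v a. C \<rhd> v a)"
proof unfold_locales
  fix v w v' w' :: "'a \<Rightarrow> 'x"
  assume in_M: "v \<in> mult_carrier ip" "w \<in> mult_carrier ip" "v' \<in> mult_carrier ip"
    "w' \<in> mult_carrier ip"
  have "(pairing ip v (w b) = pairing ip v' (w' b)) \<longleftrightarrow> (\<forall>a. ip (v a) (w b) = ip (v' a) (w' b))" for b
    using alg_mod_eqI[of "pairing ip v (w b)" "pairing ip v' (w' b)"]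
    by (auto simp: pairing_eq in_M)
  then show "mip (mult_mod (type_mod ip)) v w = mip (mult_mod (type_mod ip)) v' w' \<longleftrightarrow>
      (\<forall>i j. ip (v i) (w j) = ip (v' i) (w' j))"
    by (auto simp: mip_mult_mod fun_eq_iff)
next
  fix C D v assume CD: "adjp C D" and v: "v \<in> mult_carrier ip"
  show "(\<lambda>a. C \<rhd> v a) \<in> mult_carrier ip"
    by (rule mult_carrierI[where S = "\<lambda>y. pairing ip v (D \<rhd> y)"])
      (simp add: adjpD[OF CD] pairing_eq[OF v])
qed auto

end

section \<open>Roots of the frame operator and distance estimates\<close>

context module_frame
begin

text \<open>The upper frame bound makes 1 - T/B positive and the lower one makes it at most 1 - A/B,
  both in the A-valued sense.\<close>

lemma norm_frame_op_le:
  assumes AB: "A \<le> B"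
  shows "norm (1 - (1/B) *\<^sub>R T) \<le> 1 - A / B"
proof (rule norm_le_of_cpos)
  show "sa (1 - (1/B) *\<^sub>R T)" by (intro adjp_intros sa_T)
  fix z
  let ?z = "ip z ((1 - (1/B) *\<^sub>R T) \<rhd> z)"
  have z: "?z = ip z z - (1/B) *\<^sub>R l2_ip (U z) (U z)"
    by (simp add: bapply_simps ip_simps ip_T)
  have "?z = (1/B) *\<^sub>R (B *\<^sub>R ip z z - l2_ip (U z) (U z))"
    using B_pos by (simp add: z scaleR_diff_right)
  also have "cpos \<dots>"
    using B_pos by (intro cpos_scaleR cpos_of_cstar_pos upper) simp
  finally show "cpos ?z" .
  have "(1 - A / B) *\<^sub>R ip z z - ?z = (1/B) *\<^sub>R (l2_ip (U z) (U z) - A *\<^sub>R ip z z)"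
    by (simp add: z scaleR_diff_left scaleR_diff_right)
  also have "cpos \<dots>"
    using B_pos by (intro cpos_scaleR cpos_of_cstar_pos lower) simp
  finally show "cpos ((1 - A / B) *\<^sub>R ip z z - ?z)" .
qed (use AB B_pos in simp)

text \<open>\<open>W\<close> and \<open>R\<close> are the operators $(U^*U)^{1/2}$ and $(U^*U)^{-1/2}$.\<close>

lemma frame_op_root:
  assumes AB: "A \<le> B"
  obtains W R where "sa W" "sa R" "W * R = 1" "R * W = 1" "W * W = T"
    "norm (sqrt B *\<^sub>R 1 - W) \<le> sqrt B - sqrt A"
    "inv_sqrt_frame_op ip x = (\<rhd>) R"
    "\<And>n. canonical_parseval ip x n = (\<lambda>a. R \<rhd> x n a)"
proof (rule fourth_root[OF sa_T A_pos AB norm_frame_op_le[OF AB]], goal_cases)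
  case (1 P G)
  note P = 1(2) and G = 1(3) and PG = 1(4,5) and T = 1(6)
  interpret X: represented_module act ip "type_mod ip" "\<lambda>(_::unit) v. v" "\<lambda>C v. C \<rhd> v"
    by (rule represented_type_mod)
  interpret MX: represented_module act ip "mult_mod (type_mod ip)" "\<lambda>a v. v a" "\<lambda>C v a. C \<rhd> v a"
    by (rule represented_mult_mod)
  have L: "X.L C = (\<rhd>) C" for C by (rule ext) (simp add: X.L_def)
  have "inv_sqrt_frame_op ip x = op_inv_sqrt (type_mod ip) (X.L T)"
    unfolding inv_sqrt_frame_op_def Let_def frame_op_eq L ..
  also have "\<dots> = X.L (P * P)" by (rule X.op_inv_sqrt_L[OF P G PG T 1(8)])
  finally have X: "inv_sqrt_frame_op ip x = (\<rhd>) (P * P)" unfolding L .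
  have "op_inv_sqrt (mult_mod (type_mod ip)) (MX.L T) = MX.L (P * P)"
    by (rule MX.op_inv_sqrt_L[OF P G PG T 1(8)])
  then have MX: "canonical_parseval ip x n = (\<lambda>a. (P * P) \<rhd> x n a)" for n
    unfolding canonical_parseval_def Let_def mult_frame_op_eq by (simp add: MX.L_def x_in)
  show ?case
  proof (rule that[OF _ _ _ _ T 1(7) X MX])
    show "sa (G * G)" "sa (P * P)" by (intro adjp_intros P G)+
    show "G * G * (P * P) = 1" "P * P * (G * G) = 1"
      by (metis PG mult.assoc mult_1_left)+
  qed
qed

lemma analysis_canonical:
  assumes R: "sa R" and "\<And>n. canonical_parseval ip x n = (\<lambda>a. R \<rhd> x n a)"
  shows "analysis_op ip (canonical_parseval ip x) = U \<circ> (\<rhd>) R"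
proof (rule ext, rule ext)
  fix z n
  have "adj alg_mod (type_mod ip) (\<lambda>a. R \<rhd> x n a) = (\<lambda>z. U (R \<rhd> z) n)"
    by (rule adj_alg_modI) (simp add: adjpD[OF R] ip_x)
  then show "analysis_op ip (canonical_parseval ip x) z n = (U \<circ> (\<rhd>) R) z n"
    by (simp add: analysis_op_def pairing_def assms(2))
qed

lemma l2_norm_U:
  assumes "sa W" "W * W = T"
  shows "l2_norm (U z) = norm (W \<rhd> z)"
proof -
  have "l2_ip (U z) (U z) = ip (W \<rhd> z) (W \<rhd> z)"
    by (simp add: adjpD[OF assms(1)] flip: ip_T assms(2) bapply_times)
  then show ?thesis by (simp add: l2_norm_def norm_eq_ip)
qed

lemma op_norm_eq:
  fixes F :: "'x \<Rightarrow> nat \<Rightarrow> 'a"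
  shows "op_norm (type_mod ip) l2_mod F = (SUP z\<in>{z. norm z \<le> 1}. l2_norm (F z))"
  by (simp add: op_norm_def mnorm_def l2_norm_def norm_eq_ip)

text \<open>
  For the positive root \<open>W\<close>, the operator \<open>1 + c - W\<close> is positive and has norm at most \<open>2 c\<close>,
  hence lies within \<open>c\<close> of \<open>c\<close>.
\<close>

lemma norm_root_minus_one_le:
  assumes AB: "A \<le> B" and W: "sa W" "W * W = T"
    and approx: "norm (sqrt B *\<^sub>R 1 - W) \<le> sqrt B - sqrt A"
    and c: "1 - sqrt A \<le> c" "sqrt B - 1 \<le> c"
  shows "norm (W - 1) \<le> c"
proof -
  define P where "P = (1 + c) *\<^sub>R 1 - W"
  have "norm W \<le> sqrt B"
    by (rule norm_bop_bound) (use B_pos U_bound in \<open>simp_all flip: l2_norm_U[OF W]\<close>)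
  then have "norm ((1 + c) *\<^sub>R 1 - P) \<le> 1 + c" using c by (simp add: P_def)
  moreover have "0 \<le> 1 + c" using c(2) real_sqrt_gt_zero[OF B_pos] by linarith
  moreover have "sa P" unfolding P_def by (intro adjp_intros W)
  ultimately have "posop P" unfolding posop_def by blast
  moreover have "norm P \<le> 2 * c"
  proof -
    \<comment> \<open>The scalar 1 + c - sqrt B is nonnegative by the choice of c, and the norms of
      the two parts add up to at most 1 + c - sqrt A \<le> 2c.\<close>
    have "P = (1 + c - sqrt B) *\<^sub>R 1 + (sqrt B *\<^sub>R 1 - W)"
      by (simp add: P_def algebra_simps)
    then have "norm P \<le> norm ((1 + c - sqrt B) *\<^sub>R (1 :: 'x bop)) + norm (sqrt B *\<^sub>R 1 - W)"
      by (simp only: norm_triangle_ineq)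
    also have "norm ((1 + c - sqrt B) *\<^sub>R (1 :: 'x bop)) \<le> 1 + c - sqrt B"
      using c mult_left_mono[OF norm_bop_one[where 'x = 'x], of "1 + c - sqrt B"] by simp
    finally show ?thesis using approx c by linarith
  qed
  ultimately have "norm (P - c *\<^sub>R 1) \<le> c" by (rule norm_posop_diff_le)
  moreover have "P - c *\<^sub>R 1 = - (W - 1)" by (simp add: P_def algebra_simps)
  ultimately show ?thesis by (metis norm_minus_cancel)
qed

text \<open>\<open>F\<close> is abstract so that the estimate covers both the canonical analysis
  operator and every Parseval one. Homogeneity extends the bound from the unit ball to all of
  X.\<close>

lemma op_norm_diff_ge:
  assumes opt: "optimal_frame_bounds act ip x A B" and AB: "A \<le> B"
    and F_in: "\<And>z. F z \<in> l2" and F_norm: "\<And>z. l2_norm (F z) = norm z"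
    and F_scale: "\<And>r z n. F (r *\<^sub>R z) n = r *\<^sub>R F z n"
  shows "max (1 - sqrt A) (sqrt B - 1) \<le> op_norm (type_mod ip) l2_mod (\<lambda>z n. U z n - F z n)"
proof (rule frame_op_root[OF AB], goal_cases)
  case (1 W R)
  note W = 1(1) and R = 1(2) and WR = 1(3,4) and WW = 1(5)
  define D where "D z = l2_norm (\<lambda>n. U z n - F z n)" for z
  define c where "c = op_norm (type_mod ip) l2_mod (\<lambda>z n. U z n - F z n)"
  have bdd: "bdd_above (D ` {z. norm z \<le> 1})"
  proof (rule bdd_aboveI2)
    fix z :: 'x assume "z \<in> {z. norm z \<le> 1}"
    then have z: "norm z \<le> 1" by simp
    have "D z \<le> sqrt B * norm z + norm z"
      unfolding D_def using l2_diff(2)[OF U_in F_in, of z z] U_bound[of z] by (simp add: F_norm)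
    also have "\<dots> \<le> sqrt B * 1 + 1"
      using z B_pos by (intro add_mono mult_left_mono) simp_all
    finally show "D z \<le> sqrt B + 1" by simp
  qed
  have c: "c = (SUP z\<in>{z. norm z \<le> 1}. D z)" unfolding c_def op_norm_eq D_def ..
  have D_le: "D z \<le> c" if "norm z \<le> 1" for z
    unfolding c using that bdd by (intro cSUP_upper) simp_all
  have c0: "0 \<le> c" by (rule order_trans[OF _ D_le[of 0]]) (simp_all add: D_def l2_norm_ge0)
  have D_scale: "D (r *\<^sub>R z) = \<bar>r\<bar> * D z" for r z
  proof -
    have "U (r *\<^sub>R z) n - F (r *\<^sub>R z) n = r *\<^sub>R (U z n - F z n)" for n
      by (simp add: linear_scale[OF U_linear] F_scale scaleR_diff_right)
    moreover have d: "(\<lambda>n. U z n - F z n) \<in> l2" by (rule l2_diff(1)[OF U_in F_in])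
    then have "l2_ip (\<lambda>n. r *\<^sub>R (U z n - F z n)) (\<lambda>n. r *\<^sub>R (U z n - F z n)) =
        (r * r) *\<^sub>R l2_ip (\<lambda>n. U z n - F z n) (\<lambda>n. U z n - F z n)"
      by (simp add: star_scaleR suminf_scaleR_right l2_def)
    ultimately show ?thesis by (simp add: D_def l2_norm_def real_sqrt_mult)
  qed
  have D: "D z \<le> c * norm z" for z
  proof (cases "z = 0")
    case True then show ?thesis using D_scale[of 0 z] by simp
  next
    case False
    have "D z = norm z * D ((1 / norm z) *\<^sub>R z)"
      using D_scale[of "1 / norm z" z] False by simp
    also have "\<dots> \<le> norm z * c" using False by (intro mult_left_mono D_le) simp_all
    finally show ?thesis by (simp add: mult.commute)
  qed
  have W_le: "norm (W \<rhd> z) \<le> (1 + c) * norm z"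
    and W_ge: "(1 - c) * norm z \<le> norm (W \<rhd> z)" for z
    using l2_diff(3,4)[OF U_in F_in, of z z] D[of z]
    by (simp_all add: l2_norm_U[OF W WW] F_norm D_def algebra_simps)
  have gen: "A > 0" "B > 0" "\<And>n. x n \<in> mult_carrier ip"
    "\<And>z. summable (\<lambda>n. star (pairing ip (x n) z) * pairing ip (x n) z)"
    "\<And>z. A *\<^sub>R ip z z \<preceq> (\<Sum>n. star (pairing ip (x n) z) * pairing ip (x n) z)"
    "\<And>z. (\<Sum>n. star (pairing ip (x n) z) * pairing ip (x n) z) \<preceq> B *\<^sub>R ip z z"
    using gen_frame_bounds unfolding gen_frame_bounds_iff by blast+
  have frame_sum: "(\<Sum>n. star (pairing ip (x n) z) * pairing ip (x n) z) = ip z (T \<rhd> z)" for z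
    by (simp add: ip_T analysis_op_def)
  have "sqrt B - 1 \<le> c"
  proof -
    let ?t = "(1 + c)\<^sup>2"
    have t: "0 < ?t" using c0 by simp
    have "norm W \<le> 1 + c" using c0 W_le by (intro norm_bop_bound) simp_all
    then have "norm T \<le> ?t"
      using norm_mult_ineq[of W W] mult_mono[of "norm W" "1 + c" "norm W" "1 + c"] c0
      by (simp add: WW power2_eq_square)
    then have "norm ((1/?t) *\<^sub>R T) \<le> 1" using t by simp
    moreover have "sa ((1/?t) *\<^sub>R T)" by (intro adjp_intros sa_T)
    ultimately have "\<exists>g. \<forall>z. ip z z - ip z (((1/?t) *\<^sub>R T) \<rhd> z) = ip (g \<rhd> z) (g \<rhd> z)"
      by (rule contraction_compl_square)
    then obtain g where g: "\<And>z. ip z z - ip z (((1/?t) *\<^sub>R T) \<rhd> z) = ip (g \<rhd> z) (g \<rhd> z)"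
      by blast
    have "ip z (T \<rhd> z) \<preceq> ?t *\<^sub>R ip z z" for z
    proof -
      have "?t *\<^sub>R ip z z - ip z (T \<rhd> z) = ?t *\<^sub>R (ip z z - ip z (((1/?t) *\<^sub>R T) \<rhd> z))"
        using t by (simp add: bapply_simps ip_simps scaleR_diff_right)
      then show ?thesis
        unfolding cstar_le_def g using t by (simp add: cstar_pos_scaleR ip_pos)
    qed
    then have "gen_frame_bounds act ip x A ?t"
      unfolding gen_frame_bounds_iff using gen t by (simp add: frame_sum)
    then have "B \<le> ?t" using opt unfolding optimal_frame_bounds_def by blast
    then have "sqrt B \<le> 1 + c" using c0 by (simp add: real_le_lsqrt)
    then show ?thesis by simp
  qed
  moreover have "1 - sqrt A \<le> c"
  \<comment> \<open>A frame bound must be positive, which (1 - c)^2 is for c < 1; for c \<ge> 1 the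
    claim follows from sqrt A \<ge> 0.\<close>
  proof (cases "c < 1")
    case True
    let ?t = "(1 - c)\<^sup>2"
    have t: "0 < ?t" using True by simp
    have "norm R \<le> 1 / (1 - c)"
    proof (rule norm_bop_bound)
      fix z
      have "W \<rhd> R \<rhd> z = z" using WR by (simp flip: bapply_times)
      then show "norm (R \<rhd> z) \<le> 1 / (1 - c) * norm z"
        using W_ge[of "R \<rhd> z"] True by (simp add: field_simps)
    qed (use True in simp)
    then have "norm R * norm R \<le> (1 / (1 - c)) * (1 / (1 - c))"
      using True by (intro mult_mono) simp_all
    then have "norm (R * R) \<le> 1 / ?t"
      using norm_mult_ineq[of R R] by (simp add: power2_eq_square)
    then have "norm (?t *\<^sub>R (R * R)) \<le> 1" using t by (simp add: field_simps)
    moreover have "sa (?t *\<^sub>R (R * R))" by (intro adjp_intros R)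
    ultimately have "\<exists>g. \<forall>z. ip z z - ip z ((?t *\<^sub>R (R * R)) \<rhd> z) = ip (g \<rhd> z) (g \<rhd> z)"
      by (rule contraction_compl_square)
    then obtain g where g: "\<And>z. ip z z - ip z ((?t *\<^sub>R (R * R)) \<rhd> z) = ip (g \<rhd> z) (g \<rhd> z)"
      by blast
    have "?t *\<^sub>R ip z z \<preceq> ip z (T \<rhd> z)" for z
    proof -
      have RW: "R \<rhd> W \<rhd> z = z" for z using WR by (simp flip: bapply_times)
      have "ip (R \<rhd> W \<rhd> z) (R \<rhd> W \<rhd> z) = ip (W \<rhd> z) (R \<rhd> R \<rhd> W \<rhd> z)"
        by (rule adjpD[OF R])
      \<comment> \<open>The contraction (1 - c)^2 R^2 is evaluated at W z, where R^2 cancels the two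
        factors W.\<close>
      then have "ip z (T \<rhd> z) - ?t *\<^sub>R ip z z =
          ip (W \<rhd> z) (W \<rhd> z) - ip (W \<rhd> z) ((?t *\<^sub>R (R * R)) \<rhd> W \<rhd> z)"
        by (simp add: WW[symmetric] bapply_simps ip_simps adjpD[OF W] RW)
      then show ?thesis unfolding cstar_le_def g by (simp add: ip_pos)
    qed
    then have "gen_frame_bounds act ip x ?t B"
      unfolding gen_frame_bounds_iff using gen t by (simp add: frame_sum)
    then have "?t \<le> A" using opt unfolding optimal_frame_bounds_def by blast
    then have "1 - c \<le> sqrt A" by (rule real_le_rsqrt)
    then show ?thesis by simp
  next
    case False
    have "0 \<le> sqrt A" using A_pos by simp
    then show ?thesis using False by linarith
  qed
  ultimately show ?case by (simp add: c_def)
qed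

text \<open>If A > B, the two inequalities force X = 0. Then B/2 is an upper bound as well, against
  the minimality of B.\<close>

lemma optimal_bounds_le:
  assumes opt: "optimal_frame_bounds act ip x A B"
  shows "A \<le> B"
proof (rule ccontr)
  assume AB: "\<not> A \<le> B"
  have zero: "z = 0" for z :: 'x
  proof -
    have "(A - B) * (norm z)\<^sup>2 \<le> 0"
      using order_trans[OF U_norm_ge[of z] U_norm_le[of z]] by (simp add: algebra_simps)
    then show ?thesis using AB by (auto simp: mult_le_0_iff)
  qed
  have "ip z w = 0" for z w using zero[of z] by (simp add: ip_simps)
  then have "gen_frame_bounds act ip x A (B / 2)"
    using gen_frame_bounds unfolding gen_frame_bounds_iff by simp
  then have "B \<le> B / 2" using opt unfolding optimal_frame_bounds_def by blast
  then show False using B_pos by simp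
qed

end

theorem proposition5p8:
  fixes act :: "'x::complex_banach \<Rightarrow> 'a::cstar_algebra \<Rightarrow> 'x"
    and ip :: "'x \<Rightarrow> 'x \<Rightarrow> 'a"
    and x :: "nat \<Rightarrow> 'a \<Rightarrow> 'x"
    and A B :: real
    and U :: "'x \<Rightarrow> nat \<Rightarrow> 'a"
  assumes "hilbert_module act ip"
    and "frame_or_outer_frame act ip x"
    and "optimal_frame_bounds act ip x A B"
    and "U = analysis_op ip x"
  shows "analysis_op ip (canonical_parseval ip x) = U \<circ> inv_sqrt_frame_op ip x \<and>
         op_norm (type_mod ip) l2_mod (\<lambda>z n. U z n - (U \<circ> inv_sqrt_frame_op ip x) z n)
           = max (1 - sqrt A) (sqrt B - 1) \<and>
         (\<forall>y V. parseval_frame_or_outer_frame act ip y \<and> V = analysis_op ip y \<longrightarrow>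
            op_norm (type_mod ip) l2_mod (\<lambda>z n. U z n - V z n)
              \<ge> max (1 - sqrt A) (sqrt B - 1))"
proof -
  interpret hilbert_cs act ip using assms(1) by (rule hilbert_module.hilbert_cs)
  have "gen_frame_bounds act ip x A B"
    using assms(3) unfolding optimal_frame_bounds_def by blast
  then interpret module_frame act ip x A B
    by unfold_locales
  have AB: "A \<le> B" by (rule optimal_bounds_le[OF assms(3)])
  obtain W R where W: "sa W" and R: "sa R" and WR: "W * R = 1" "R * W = 1" and WW: "W * W = T"
    and approx: "norm (sqrt B *\<^sub>R 1 - W) \<le> sqrt B - sqrt A"
    and inv: "inv_sqrt_frame_op ip x = (\<rhd>) R"
    and can: "\<And>n. canonical_parseval ip x n = (\<lambda>a. R \<rhd> x n a)"
    by (rule frame_op_root[OF AB]) (rule that)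
  let ?c = "max (1 - sqrt A) (sqrt B - 1)"
  let ?N = "op_norm (type_mod ip) l2_mod (\<lambda>z n. U z n - (U \<circ> inv_sqrt_frame_op ip x) z n)"
  have U: "U z = analysis_op ip x z" for z by (simp add: assms(4))
  have "?N \<le> ?c"
    unfolding op_norm_eq
  proof (rule cSUP_least)
    fix z :: 'x assume "z \<in> {z. norm z \<le> 1}"
    then have z: "norm z \<le> 1" by simp
    \<comment> \<open>U z - U R z is U at z - R z, and U has the same norms as W; since W R = 1, the
      vector becomes (W - 1) z.\<close>
    have "(\<lambda>n. U z n - (U \<circ> inv_sqrt_frame_op ip x) z n) = analysis_op ip x (z - R \<rhd> z)"
      by (simp add: U inv linear_diff[OF U_linear] fun_eq_iff)
    then have "l2_norm (\<lambda>n. U z n - (U \<circ> inv_sqrt_frame_op ip x) z n) = norm (W \<rhd> (z - R \<rhd> z))"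
      by (simp add: l2_norm_U[OF W WW])
    also have "W \<rhd> (z - R \<rhd> z) = W \<rhd> z - (W * R) \<rhd> z"
      by (simp only: bapply.diff_right bapply_times)
    also have "\<dots> = (W - 1) \<rhd> z" by (simp add: WR bapply_simps)
    also have "norm ((W - 1) \<rhd> z) \<le> norm (W - 1) * norm z" by (rule norm_bapply)
    also have "\<dots> \<le> norm (W - 1)" using z by (simp add: mult_left_le)
    also have "\<dots> \<le> ?c" by (rule norm_root_minus_one_le[OF AB W WW approx]) simp_all
    finally show "l2_norm (\<lambda>n. U z n - (U \<circ> inv_sqrt_frame_op ip x) z n) \<le> ?c" .
  qed (auto intro: exI[of _ 0])
  \<comment> \<open>U R is isometric because W R = 1, so the lower estimate applies to it
    directly.\<close>
  moreover have "?c \<le> ?N"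
    unfolding assms(4)
  proof (rule op_norm_diff_ge[OF assms(3) AB])
    fix z r n
    show "(analysis_op ip x \<circ> inv_sqrt_frame_op ip x) z \<in> l2" by (simp add: U_in)
    have "l2_norm ((analysis_op ip x \<circ> inv_sqrt_frame_op ip x) z) = norm ((W * R) \<rhd> z)"
      by (simp add: inv l2_norm_U[OF W WW] bapply_times)
    then show "l2_norm ((analysis_op ip x \<circ> inv_sqrt_frame_op ip x) z) = norm z"
      by (simp add: WR)
    show "(analysis_op ip x \<circ> inv_sqrt_frame_op ip x) (r *\<^sub>R z) n =
        r *\<^sub>R (analysis_op ip x \<circ> inv_sqrt_frame_op ip x) z n"
      by (simp add: inv bapply_simps linear_scale[OF U_linear])
  qed
  moreover have "?c \<le> op_norm (type_mod ip) l2_mod (\<lambda>z n. U z n - V z n)"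
    if y: "parseval_frame_or_outer_frame act ip y" and V: "V = analysis_op ip y" for y V
  proof -
    interpret y: module_frame act ip y 1 1
      using y by unfold_locales (simp add: parseval_frame_or_outer_frame_def)
    \<comment> \<open>With both frame bounds equal to 1 the two norm estimates coincide, so V is
      isometric.\<close>
    have "(l2_norm (V z))\<^sup>2 = (norm z)\<^sup>2" for z
      using y.U_norm_le[of z] y.U_norm_ge[of z] by (simp add: V)
    then have "l2_norm (V z) = norm z" for z
      by (rule power2_eq_imp_eq) (simp_all add: l2_norm_ge0)
    then show ?thesis
      unfolding assms(4)
      by (intro op_norm_diff_ge[OF assms(3) AB])
        (simp_all add: V y.U_in linear_scale[OF y.U_linear])
  qed
  ultimately show ?thesis
    using analysis_canonical[OF R can] by (auto simp: assms(4) inv)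
qed

end
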